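(* There is an algorithm that, given a positive integer $k\le d$, $\eta\in(0,1)$, and sample access to a distribution over pairs $(\mathbf x,y)\in\{\pm1\}^d\times\{\pm1\}$ that has total variation distance at most $\eta$ from a distribution over $(\mathbf x,y)$ in which $\mathbf x$ is uniform over $\{\pm1\}^d$ and $y=\mathrm{sign}(\mathbf v^*\cdot\mathbf x+\tau^* )$ for some unknown $\mathbf v^*\in\mathbb{R}^d,\tau^*\in\mathbb{R}$, outputs, with probability at least $0.995$, a set of $k$ indices $\{j_1,\dots,j_k\}\subseteq[d]$ such that there is a vector $\tilde{\mathbf v}^*\in\mathbb{R}^d$ whose $k$ largest (in absolute value) coefficients are located at the indices $j_1,\dots,j_k$ and \[ \Pr_{\mathbf x\sim\{\pm1\}^d}\big[\mathrm{sign}(\mathbf v^*\cdot\mathbf x+\tau^* )\neq\mathrm{sign}(\tilde{\mathbf v}^*\cdot\mathbf x+\tau^* )\big]\leq 4\eta k . \] The algorithm has time and sample complexity $\mathrm{poly}(d,1/\eta)$.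
   Context: $\mathrm{sign}:\mathbb{R}\to\{\pm1\}$ is the sign function; $\mathbf x\sim\{\pm1\}^d$ denotes the uniform distribution. *)

theory Defs
  imports "HOL-Probability.Probability"
begin

section \<open>Halfspaces on the cube\<close>

text \<open>A vector in \<open>\<real>\<close>-space of dimension \<open>d\<close> is a function on \<open>nat\<close> of which only the
  coordinates \<open>1, \<dots>, d\<close> are used, since a single algorithm has to serve all \<open>d\<close>.\<close>

definition cube :: "nat \<Rightarrow> (nat \<Rightarrow> int) set" where
  "cube d = PiE {1..d} (\<lambda>_. {-1, 1})"

text \<open>Unlike \<^const>\<open>sgn\<close>, this takes values in \<open>{-1, 1}\<close>; the value at \<open>0\<close> is \<open>1\<close>.\<close>

definition sign_pm :: "real \<Rightarrow> int" where
  "sign_pm r = (if 0 \<le> r then 1 else -1)"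

definition halfspace :: "nat \<Rightarrow> (nat \<Rightarrow> real) \<Rightarrow> real \<Rightarrow> (nat \<Rightarrow> int) \<Rightarrow> int" where
  "halfspace d v \<tau> x = sign_pm ((\<Sum>i = 1..d. v i * real_of_int (x i)) + \<tau>)"

definition halfspace_pmf :: "nat \<Rightarrow> (nat \<Rightarrow> real) \<Rightarrow> real \<Rightarrow> ((nat \<Rightarrow> int) \<times> int) pmf" where
  "halfspace_pmf d v \<tau> = map_pmf (\<lambda>x. (x, halfspace d v \<tau> x)) (pmf_of_set (cube d))"

definition tv_dist :: "'a pmf \<Rightarrow> 'a pmf \<Rightarrow> real" where
  "tv_dist p q = (SUP A. \<bar>measure_pmf.prob p A - measure_pmf.prob q A\<bar>)"

definition largest_coeffs_at :: "nat \<Rightarrow> (nat \<Rightarrow> real) \<Rightarrow> nat set \<Rightarrow> bool" where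
  "largest_coeffs_at d w J \<longleftrightarrow> (\<forall>i\<in>J. \<forall>j\<in>{1..d} - J. \<bar>w j\<bar> \<le> \<bar>w i\<bar>)"


section \<open>A randomized machine model with sample access\<close>

text \<open>
  Programs are while programs over integer and real arrays (a scalar is the entry \<open>0\<close> of an
  array). Every elementary instruction and every evaluation of a guard takes one time step; that
  loading the \<open>d\<close> coordinates of a sample is a single step changes time by a factor \<open>O(d)\<close> only.

  The only arithmetic is addition, subtraction and comparison, and all constants are integers.
  Thus numbers cannot grow by more than a constant factor per step, so that unit costs do not
  allow exponentially long numbers to be processed in polynomial time, and no information can be
  hidden in real constants. Real memory is there because the parameter \<open>\<eta>\<close> is an arbitrary real.
\<close>

type_synonym vname = string

datatype iexp =
    IConst int
  | IArr vname iexp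
  | IAdd iexp iexp
  | ISub iexp iexp

datatype rexp =
    ROfInt iexp
  | RArr vname iexp
  | RAdd rexp rexp
  | RSub rexp rexp

datatype bexp =
    ILess iexp iexp
  | RLess rexp rexp
  | BNot bexp
  | BAnd bexp bexp

datatype com =
    Skip
  | ISet vname iexp iexp  \<comment> \<open>array, index, value\<close>
  | RSet vname iexp rexp
  | Flip vname
  | Sample
  | Seq com com
  | Cond bexp com com
  | While bexp com

record state =
  imem :: "vname \<Rightarrow> nat \<Rightarrow> int"
  rmem :: "vname \<Rightarrow> nat \<Rightarrow> real"
  drawn :: nat  \<comment> \<open>number of samples drawn so far; not readable by programs\<close>

text \<open>Negative indices address the entry \<open>0\<close>, by the convention of \<^const>\<open>nat\<close>.\<close>

primrec ival :: "iexp \<Rightarrow> state \<Rightarrow> int" where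
  "ival (IConst c) s = c"
| "ival (IArr a e) s = imem s a (nat (ival e s))"
| "ival (IAdd e f) s = ival e s + ival f s"
| "ival (ISub e f) s = ival e s - ival f s"

primrec rval :: "rexp \<Rightarrow> state \<Rightarrow> real" where
  "rval (ROfInt e) s = real_of_int (ival e s)"
| "rval (RArr a e) s = rmem s a (nat (ival e s))"
| "rval (RAdd e f) s = rval e s + rval f s"
| "rval (RSub e f) s = rval e s - rval f s"

primrec bval :: "bexp \<Rightarrow> state \<Rightarrow> bool" where
  "bval (ILess e f) s = (ival e s < ival f s)"
| "bval (RLess e f) s = (rval e s < rval f s)"
| "bval (BNot b) s = (\<not> bval b s)"
| "bval (BAnd b c) s = (bval b s \<and> bval c s)"

definition iset :: "vname \<Rightarrow> nat \<Rightarrow> int \<Rightarrow> state \<Rightarrow> state" where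
  "iset a n z s = s\<lparr>imem := (imem s)(a := (imem s a)(n := z))\<rparr>"

definition rset :: "vname \<Rightarrow> nat \<Rightarrow> real \<Rightarrow> state \<Rightarrow> state" where
  "rset a n r s = s\<lparr>rmem := (rmem s)(a := (rmem s a)(n := r))\<rparr>"

definition receive :: "nat \<Rightarrow> (nat \<Rightarrow> int) \<times> int \<Rightarrow> state \<Rightarrow> state" where
  "receive d xy s =
     iset ''y'' 0 (snd xy)
       (s\<lparr>imem := (imem s)(''x'' := (\<lambda>i. if i \<in> {1..d} then fst xy i else imem s ''x'' i)),
          drawn := drawn s + 1\<rparr>)"

text \<open>
  Small-step semantics when the examples come from the distribution \<open>D\<close>. Each \<^const>\<open>Sample\<close>
  draws a fresh example, independent of the past, into \<open>x[1..d]\<close> and \<open>y[0]\<close>; each \<^const>\<open>Flip\<close>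
  tosses a fair coin. A program has halted when it has become \<^const>\<open>Skip\<close>.
\<close>

primrec step :: "nat \<Rightarrow> ((nat \<Rightarrow> int) \<times> int) pmf \<Rightarrow> com \<Rightarrow> state \<Rightarrow> (com \<times> state) pmf" where
  "step d D Skip s = return_pmf (Skip, s)"
| "step d D (ISet a i e) s = return_pmf (Skip, iset a (nat (ival i s)) (ival e s) s)"
| "step d D (RSet a i e) s = return_pmf (Skip, rset a (nat (ival i s)) (rval e s) s)"
| "step d D (Flip a) s =
     map_pmf (\<lambda>b. (Skip, iset a 0 (if b then 1 else 0) s)) (bernoulli_pmf (1 / 2))"
| "step d D Sample s = map_pmf (\<lambda>xy. (Skip, receive d xy s)) D"
| "step d D (Seq P Q) s =
     (if P = Skip then return_pmf (Q, s)
      else map_pmf (\<lambda>(P', s'). (Seq P' Q, s')) (step d D P s))"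
| "step d D (Cond b P Q) s = return_pmf (if bval b s then P else Q, s)"
| "step d D (While b P) s =
     return_pmf (if bval b s then Seq P (While b P) else Skip, s)"

primrec run :: "nat \<Rightarrow> ((nat \<Rightarrow> int) \<times> int) pmf \<Rightarrow> nat \<Rightarrow> com \<times> state \<Rightarrow> (com \<times> state) pmf" where
  "run d D 0 c = return_pmf c"
| "run d D (Suc t) c = bind_pmf (step d D (fst c) (snd c)) (run d D t)"

definition init :: "nat \<Rightarrow> nat \<Rightarrow> real \<Rightarrow> state" where
  "init d k \<eta> =
     iset ''d'' 0 (int d) (iset ''k'' 0 (int k) (rset ''eta'' 0 \<eta>
       \<lparr>imem = (\<lambda>_ _. 0), rmem = (\<lambda>_ _. 0), drawn = 0\<rparr>))"

definition output_set :: "nat \<Rightarrow> state \<Rightarrow> nat set" where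
  "output_set k s = (\<lambda>l. nat (imem s ''out'' l)) ` {1..k}"

text \<open>For \<open>d \<ge> 1\<close> and \<open>0 < \<eta> < 1\<close> every bivariate polynomial in \<open>d\<close> and \<open>1 / \<eta>\<close> is dominated by
  a monomial.\<close>

definition poly_bounded :: "(nat \<Rightarrow> real \<Rightarrow> nat) \<Rightarrow> bool" where
  "poly_bounded f \<longleftrightarrow>
     (\<exists>(C::real) (a::nat) (b::nat). \<forall>d\<ge>1. \<forall>\<eta>. 0 < \<eta> \<and> \<eta> < 1 \<longrightarrow>
        real (f d \<eta>) \<le> C * real d ^ a * (1 / \<eta>) ^ b)"

end

theory Submission
  imports Defs
begin

text \<open>
  The algorithm estimates the degree-one Chow parameters \<open>E[f(x) x\<^sub>i]\<close> of the halfspace \<open>f\<close> from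
  \<open>64 d \<lceil>1/\<eta>\<rceil>\<^sup>2\<close> examples and returns the indices of the \<open>k\<close> largest estimates in absolute
  value. The corruption moves each parameter by at most \<open>2\<eta>\<close>, and by Chebyshev's inequality so does
  the sampling error, for all indices at once with probability at least \<open>1 - 1/256\<close>.

  If \<open>\<bar>v\<^sub>j\<bar> \<le> \<bar>v\<^sub>i\<bar>\<close>, then exchanging the two coefficients up to sign changes \<open>f\<close> with probability
  exactly half the difference of the absolute Chow parameters of \<open>i\<close> and \<open>j\<close>. When \<open>i\<close> is among the
  \<open>k\<close> largest coefficients but not returned, and \<open>j\<close> the other way round, that difference is at most
  \<open>8\<eta>\<close>. Matching such indices in pairs, at most \<open>k\<close> exchanges, each costing at most \<open>4\<eta>\<close>, move the
  largest coefficients to the returned indices; as the pairs are disjoint, each cost can be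
  measured on the original halfspace.
\<close>

type_synonym example = "(nat \<Rightarrow> int) \<times> int"

section \<open>Program logic\<close>

lemma run_Skip [simp]: "run d D t (Skip, s) = return_pmf (Skip, s)"
  by (induction t) (auto simp: bind_return_pmf)

lemma run_add: "run d D (t + u) c = bind_pmf (run d D t c) (run d D u)"
proof (induction t arbitrary: c)
  case (Suc t)
  then show ?case by (simp add: bind_assoc_pmf cong: bind_pmf_cong)
qed (simp add: bind_return_pmf)

lemma run_Seq:
  assumes "\<And>R s'. (R, s') \<in> set_pmf (run d D t (P, s)) \<Longrightarrow> R = Skip"
    and "\<And>R s' R' s''. (R, s') \<in> set_pmf (run d D t (P, s)) \<Longrightarrow>
           (R', s'') \<in> set_pmf (run d D u (Q, s')) \<Longrightarrow> R' = Skip"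
  shows "run d D (t + 1 + u) (Seq P Q, s) =
           bind_pmf (run d D t (P, s)) (\<lambda>(R, s'). run d D u (Q, s'))"
  using assms
proof (induction t arbitrary: P s)
  case 0
  then show ?case by (simp add: bind_return_pmf)
next
  case (Suc t)
  show ?case
  proof (cases "P = Skip")
    case True
    \<comment> \<open>\<open>P\<close> has halted with \<open>t\<close> steps to spare: they are
      moved behind the run of \<open>Q\<close>, where they act as the identity.\<close>
    have "run d D (t + 1 + u) (Q, s) = bind_pmf (run d D u (Q, s)) (run d D (t + 1))"
      by (metis add.commute run_add)
    also have "\<dots> = bind_pmf (run d D u (Q, s)) return_pmf"
    proof (rule bind_pmf_cong[OF refl])
      fix c assume c: "c \<in> set_pmf (run d D u (Q, s))"
      obtain R s' where "c = (R, s')" by (cases c)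
      moreover from this c have "R = Skip"
        using Suc.prems(2)[of Skip s R s'] True by simp
      ultimately show "run d D (t + 1) c = return_pmf c" by (simp only: run_Skip)
    qed
    finally show ?thesis
      using True by (simp add: bind_return_pmf bind_return_pmf')
  next
    case False
    have IH: "run d D (t + 1 + u) (Seq P' Q, s') =
           bind_pmf (run d D t (P', s')) (\<lambda>(R, s'). run d D u (Q, s'))"
      if "(P', s') \<in> set_pmf (step d D P s)" for P' s'
    proof (rule Suc.IH)
      fix R s'' assume "(R, s'') \<in> set_pmf (run d D t (P', s'))"
      then have mem: "(R, s'') \<in> set_pmf (run d D (Suc t) (P, s))"
        using that by (auto intro!: bexI[of _ "(P', s')"])
      then show "R = Skip" by (rule Suc.prems(1))
      fix R' s3 assume "(R', s3) \<in> set_pmf (run d D u (Q, s''))"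
      with mem show "R' = Skip" by (rule Suc.prems(2))
    qed
    have "run d D (Suc t + 1 + u) (Seq P Q, s) =
        bind_pmf (step d D P s) (\<lambda>(P', s'). run d D (t + 1 + u) (Seq P' Q, s'))"
      using False by (simp add: bind_map_pmf split_def)
    also have "\<dots> = bind_pmf (step d D P s) (\<lambda>(P', s').
        bind_pmf (run d D t (P', s')) (\<lambda>(R, s'). run d D u (Q, s')))"
      using IH by (intro bind_pmf_cong) auto
    also have "\<dots> = bind_pmf (run d D (Suc t) (P, s)) (\<lambda>(R, s'). run d D u (Q, s'))"
      by (simp add: bind_assoc_pmf split_def)
    finally show ?thesis .
  qed
qed

text \<open>The number \<open>n\<close> of examples drawn is the same on every path, so the final state is a
  function of a list of \<open>n\<close> independent examples.\<close>

definition triple :: "nat \<Rightarrow> example pmf \<Rightarrow> com \<Rightarrow> state \<Rightarrow> nat \<Rightarrow> nat \<Rightarrow>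
    (example list \<Rightarrow> state \<Rightarrow> bool) \<Rightarrow> bool" where
  "triple d D P s t n Post \<longleftrightarrow>
     (\<exists>G. run d D t (P, s) = map_pmf (\<lambda>\<omega>. (Skip, G \<omega>)) (replicate_pmf n D) \<and>
          (\<forall>\<omega>\<in>set_pmf (replicate_pmf n D). Post \<omega> (G \<omega>)))"

text \<open>A halted configuration is a fixed point, so additional time is harmless. The implication
  between postconditions may use that the list has length \<open>n\<close> and entries in the
  support of \<open>D\<close>.\<close>

lemma triple_weaken:
  assumes "triple d D P s t n Post" and "t \<le> t'"
    and "\<And>\<omega> s'. length \<omega> = n \<Longrightarrow> set \<omega> \<subseteq> set_pmf D \<Longrightarrow> Post \<omega> s' \<Longrightarrow> Post' \<omega> s'"
  shows "triple d D P s t' n Post'"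
proof -
  obtain G where G: "run d D t (P, s) = map_pmf (\<lambda>\<omega>. (Skip, G \<omega>)) (replicate_pmf n D)"
    "\<forall>\<omega>\<in>set_pmf (replicate_pmf n D). Post \<omega> (G \<omega>)"
    using assms(1) by (auto simp: triple_def)
  have "run d D t' (P, s) = bind_pmf (run d D t (P, s)) (run d D (t' - t))"
    using assms(2) run_add[of d D t "t' - t"] by simp
  also have "\<dots> = map_pmf (\<lambda>\<omega>. (Skip, G \<omega>)) (replicate_pmf n D)"
    unfolding G(1) by (simp add: bind_assoc_pmf bind_return_pmf map_pmf_def)
  finally show ?thesis
    using G(2) assms(3) unfolding triple_def
    by (intro exI[of _ G]) (auto simp: set_replicate_pmf)
qed

text \<open>Independent lists of lengths \<open>n\<close> and \<open>m\<close>, concatenated, are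
  distributed as one list of length \<open>n + m\<close>. Cutting that list at position
  \<open>n\<close> recovers both parts, so the final state is again a function of the list. The
  postcondition of \<open>Q\<close> sees the examples read by \<open>P\<close> as a prefix.\<close>

lemma triple_Seq:
  assumes P: "triple d D P s t n Mid"
    and Q: "\<And>\<omega> s'. length \<omega> = n \<Longrightarrow> set \<omega> \<subseteq> set_pmf D \<Longrightarrow> Mid \<omega> s' \<Longrightarrow>
      triple d D Q s' u m (\<lambda>\<omega>'. Post (\<omega> @ \<omega>'))"
  shows "triple d D (Seq P Q) s (t + 1 + u) (n + m) Post"
proof -
  obtain G where G: "run d D t (P, s) = map_pmf (\<lambda>\<omega>. (Skip, G \<omega>)) (replicate_pmf n D)"
    "\<forall>\<omega>\<in>set_pmf (replicate_pmf n D). Mid \<omega> (G \<omega>)"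
    using P by (auto simp: triple_def)
  have "\<forall>\<omega>\<in>set_pmf (replicate_pmf n D). triple d D Q (G \<omega>) u m (\<lambda>\<omega>'. Post (\<omega> @ \<omega>'))"
    using G(2) Q by (auto simp: set_replicate_pmf)
  then obtain H where H: "\<And>\<omega>. \<omega> \<in> set_pmf (replicate_pmf n D) \<Longrightarrow>
      run d D u (Q, G \<omega>) = map_pmf (\<lambda>\<omega>'. (Skip, H \<omega> \<omega>')) (replicate_pmf m D) \<and>
      (\<forall>\<omega>'\<in>set_pmf (replicate_pmf m D). Post (\<omega> @ \<omega>') (H \<omega> \<omega>'))"
    unfolding triple_def by metis
  define K where "K \<zeta> = H (take n \<zeta>) (drop n \<zeta>)" for \<zeta>
  have "run d D (t + 1 + u) (Seq P Q, s) =
      bind_pmf (run d D t (P, s)) (\<lambda>(R, s'). run d D u (Q, s'))"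
    using H by (intro run_Seq) (auto simp: G(1))
  also have "\<dots> = bind_pmf (replicate_pmf n D) (\<lambda>\<omega>. run d D u (Q, G \<omega>))"
    by (simp add: G(1) bind_map_pmf)
  also have "\<dots> = bind_pmf (replicate_pmf n D) (\<lambda>\<omega>. bind_pmf (replicate_pmf m D)
      (\<lambda>\<omega>'. return_pmf (Skip, K (\<omega> @ \<omega>'))))"
    using H by (intro bind_pmf_cong) (auto simp: K_def map_pmf_def set_replicate_pmf)
  also have "\<dots> = map_pmf (\<lambda>\<zeta>. (Skip, K \<zeta>)) (replicate_pmf (n + m) D)"
    unfolding replicate_pmf_distrib map_pmf_def
    by (simp add: bind_assoc_pmf bind_return_pmf)
  finally have run: "run d D (t + 1 + u) (Seq P Q, s) = \<dots>" .
  have "Post \<zeta> (K \<zeta>)" if "\<zeta> \<in> set_pmf (replicate_pmf (n + m) D)" for \<zeta>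
  proof -
    from that have *: "length \<zeta> = n + m" "set \<zeta> \<subseteq> set_pmf D"
      by (auto simp: set_replicate_pmf)
    then have "take n \<zeta> \<in> set_pmf (replicate_pmf n D)" "drop n \<zeta> \<in> set_pmf (replicate_pmf m D)"
      by (auto simp: set_replicate_pmf dest: in_set_takeD in_set_dropD)
    from H[OF this(1)] this(2) show ?thesis by (auto simp: K_def)
  qed
  with run show ?thesis unfolding triple_def by blast
qed

section \<open>Rules for the individual commands\<close>

lemma triple_Skip: "Post [] s \<Longrightarrow> triple d D Skip s t 0 Post"
  by (auto simp: triple_def)

lemma triple_ISet:
  "Post [] (iset a (nat (ival i s)) (ival e s) s) \<Longrightarrow> triple d D (ISet a i e) s 1 0 Post"
  by (auto simp: triple_def bind_return_pmf)

lemma triple_RSet: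
  "Post [] (rset a (nat (ival i s)) (rval e s) s) \<Longrightarrow> triple d D (RSet a i e) s 1 0 Post"
  by (auto simp: triple_def bind_return_pmf)

lemma triple_Sample:
  assumes "\<And>xy. xy \<in> set_pmf D \<Longrightarrow> Post [xy] (receive d xy s)"
  shows "triple d D Sample s 1 1 Post"
proof -
  have "run d D 1 (Sample, s) = map_pmf (\<lambda>\<omega>. (Skip, receive d (hd \<omega>) s)) (replicate_pmf 1 D)"
    unfolding replicate_pmf_1
    by (simp add: map_pmf_comp bind_map_pmf bind_return_pmf' map_pmf_def[symmetric] o_def)
  then show ?thesis
    using assms unfolding triple_def
    by (intro exI[of _ "\<lambda>\<omega>. receive d (hd \<omega>) s"]) (auto simp: replicate_pmf_1)
qed

lemma triple_Cond:
  assumes "bval b s \<Longrightarrow> triple d D P s t n Post" and "\<not> bval b s \<Longrightarrow> triple d D Q s t n Post"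
  shows "triple d D (Cond b P Q) s (t + 1) n Post"
  using assms by (cases "bval b s") (auto simp: triple_def bind_return_pmf)

text \<open>Of the two additional steps, one executes the assignment and one discards the resulting
  \<open>Skip\<close>.\<close>

lemma triple_ISet_Seq:
  assumes "triple d D Q (iset a (nat (ival i s)) (ival e s) s) t n Post"
  shows "triple d D (Seq (ISet a i e) Q) s (t + 2) n Post"
proof -
  have "triple d D (Seq (ISet a i e) Q) s (1 + 1 + t) (0 + n) Post"
  proof (rule triple_Seq)
    show "triple d D (ISet a i e) s 1 0 (\<lambda>\<omega> s'. \<omega> = [] \<and> s' = iset a (nat (ival i s)) (ival e s) s)"
      by (rule triple_ISet) simp
  qed (use assms in simp)
  then show ?thesis by (simp add: add.commute)
qed

lemma triple_RSet_Seq: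
  assumes "triple d D Q (rset a (nat (ival i s)) (rval e s) s) t n Post"
  shows "triple d D (Seq (RSet a i e) Q) s (t + 2) n Post"
proof -
  have "triple d D (Seq (RSet a i e) Q) s (1 + 1 + t) (0 + n) Post"
  proof (rule triple_Seq)
    show "triple d D (RSet a i e) s 1 0 (\<lambda>\<omega> s'. \<omega> = [] \<and> s' = rset a (nat (ival i s)) (rval e s) s)"
      by (rule triple_RSet) simp
  qed (use assms in simp)
  then show ?thesis by (simp add: add.commute)
qed

text \<open>The invariant is indexed by the number of completed rounds and the list of examples read
  so far. Each round adds to the body one step for the guard and one for the discarded
  \<open>Skip\<close>; the final step is the failing guard. The number of rounds is the same on all
  paths, as the format of \<open>triple\<close> requires.\<close>

lemma triple_While:
  assumes step: "\<And>j \<omega> s. j < N \<Longrightarrow> I j \<omega> s \<Longrightarrow>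
      bval b s \<and> triple d D P s t n (\<lambda>\<omega>'. I (Suc j) (\<omega> @ \<omega>'))"
    and stop: "\<And>\<omega> s. I N \<omega> s \<Longrightarrow> \<not> bval b s"
    and start: "I 0 [] s"
  shows "triple d D (While b P) s (N * (t + 2) + 1) (N * n) (I N)"
proof -
  \<comment> \<open>Generalised to a loop entered after \<open>j\<close> rounds with
    \<open>\<omega>\<close> already read, for induction on the remaining rounds.\<close>
  have "triple d D (While b P) s ((N - j) * (t + 2) + 1) ((N - j) * n) (\<lambda>\<omega>'. I N (\<omega> @ \<omega>'))"
    if "j \<le> N" "I j \<omega> s" for j \<omega> s
    using that
  proof (induction "N - j" arbitrary: j \<omega> s)
    case 0
    then have "j = N" by simp
    with 0 stop[of \<omega> s] show ?case by (auto simp: triple_def bind_return_pmf)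
  next
    case (Suc l)
    then have j: "j < N" and l: "l = N - Suc j" by simp_all
    note * = step[OF j Suc.prems(2)]
    have "triple d D (Seq P (While b P)) s (t + 1 + (l * (t + 2) + 1)) (n + l * n)
        (\<lambda>\<omega>'. I N (\<omega> @ \<omega>'))"
    proof (rule triple_Seq[OF conjunct2[OF *]])
      fix \<omega>' s' assume "I (Suc j) (\<omega> @ \<omega>') s'"
      then show "triple d D (While b P) s' (l * (t + 2) + 1) (l * n)
          (\<lambda>\<omega>''. I N (\<omega> @ \<omega>' @ \<omega>''))"
        using Suc.hyps(1)[OF l _ , of "\<omega> @ \<omega>'" s'] j by (simp add: l)
    qed
    moreover have "N - j = Suc l" using j l by simp
    ultimately show ?case
      using * by (simp add: triple_def bind_return_pmf algebra_simps)
  qed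
  from this[of 0 "[]" s] start show ?thesis by simp
qed

lemma triple_While0:
  assumes "\<And>j s. j < N \<Longrightarrow> I j s \<Longrightarrow> bval b s \<and> triple d D P s t 0 (\<lambda>_. I (Suc j))"
    and "\<And>s. I N s \<Longrightarrow> \<not> bval b s"
    and "I 0 s"
  shows "triple d D (While b P) s (N * (t + 2) + 1) 0 (\<lambda>_. I N)"
  using triple_While[of N "\<lambda>j _. I j" b d D P t 0 s] assms by simp

section \<open>Chow parameters of halfspaces\<close>

lemma finite_cube [simp]: "finite (cube d)"
  unfolding cube_def by (rule finite_PiE) simp_all

lemma cube_nonempty [simp]: "cube d \<noteq> {}"
  unfolding cube_def by (simp add: PiE_eq_empty_iff)

lemma cube_coord: "x \<in> cube d \<Longrightarrow> i \<in> {1..d} \<Longrightarrow> x i = 1 \<or> x i = - 1"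
  unfolding cube_def using PiE_mem[of x "{1..d}" "\<lambda>_. {-1, 1}" i] by simp blast

lemma cube_fun_upd:
  assumes "x \<in> cube d" "i \<in> {1..d}" "a = 1 \<or> a = - 1"
  shows "x(i := a) \<in> cube d"
  using PiE_fun_upd[of a "\<lambda>_. {-1, 1}" i x "{1..d}"] assms
  by (auto simp: cube_def insert_absorb)

definition chow :: "nat \<Rightarrow> (nat \<Rightarrow> real) \<Rightarrow> real \<Rightarrow> nat \<Rightarrow> real" where
  "chow d v \<tau> i = measure_pmf.expectation (pmf_of_set (cube d))
     (\<lambda>x. real_of_int (halfspace d v \<tau> x * x i))"

lemma integrable_cube [simp]:
  fixes g :: "(nat \<Rightarrow> int) \<Rightarrow> real"
  shows "integrable (measure_pmf (pmf_of_set (cube d))) g"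
  by (rule integrable_measure_pmf_finite) simp

lemma map_pmf_cube_involution:
  assumes "\<And>x. x \<in> cube d \<Longrightarrow> \<phi> x \<in> cube d" "\<And>x. x \<in> cube d \<Longrightarrow> \<phi> (\<phi> x) = x"
  shows "map_pmf \<phi> (pmf_of_set (cube d)) = pmf_of_set (cube d)"
proof (rule map_pmf_of_set_bij_betw)
  show "bij_betw \<phi> (cube d) (cube d)"
    by (rule bij_betw_byWitness[where f' = \<phi>]) (use assms in auto)
qed auto

text \<open>Pairing \<open>x\<close> with \<open>\<phi> x\<close>: as \<open>g\<close> is odd under \<open>\<phi>\<close>, only the points at which the sign changes
  contribute, and there the sign of \<open>g\<close> is that of the change.\<close>

lemma expectation_sign_times_odd:
  fixes L g :: "(nat \<Rightarrow> int) \<Rightarrow> real"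
  assumes inv: "\<And>x. x \<in> cube d \<Longrightarrow> \<phi> x \<in> cube d" "\<And>x. x \<in> cube d \<Longrightarrow> \<phi> (\<phi> x) = x"
    and odd: "\<And>x. x \<in> cube d \<Longrightarrow> g (\<phi> x) = - g x"
    and L: "\<And>x. x \<in> cube d \<Longrightarrow> L x - L (\<phi> x) = c * g x" and "0 \<le> c"
    and val: "\<And>x. x \<in> cube d \<Longrightarrow> \<bar>g x\<bar> = 0 \<or> \<bar>g x\<bar> = b"
  shows "measure_pmf.expectation (pmf_of_set (cube d)) (\<lambda>x. sign_pm (L x) * g x) =
    b * measure_pmf.prob (pmf_of_set (cube d)) {x. sign_pm (L x) \<noteq> sign_pm (L (\<phi> x))}"
proof -
  let ?E = "measure_pmf.expectation (pmf_of_set (cube d))"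
  let ?f = "\<lambda>x. real_of_int (sign_pm (L x))"
  have "?E (\<lambda>x. ?f x * g x) = measure_pmf.expectation (map_pmf \<phi> (pmf_of_set (cube d))) (\<lambda>x. ?f x * g x)"
    by (simp only: map_pmf_cube_involution[OF inv])
  also have "\<dots> = ?E (\<lambda>x. - (?f (\<phi> x) * g x))"
    unfolding integral_map_pmf by (intro integral_cong_AE) (auto simp: AE_measure_pmf_iff odd)
  \<comment> \<open>Invariance of the uniform distribution under \<open>\<phi>\<close> and oddness
    of \<open>g\<close> give a second expression for the same expectation; the two are
    added.\<close>
  finally have "2 * ?E (\<lambda>x. ?f x * g x) = ?E (\<lambda>x. ?f x * g x + - (?f (\<phi> x) * g x))"
    by (subst Bochner_Integration.integral_add) auto
  also have "\<dots> = ?E (\<lambda>x. 2 * b * indicator {x. sign_pm (L x) \<noteq> sign_pm (L (\<phi> x))} x)"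
  proof (intro integral_cong_AE)
    have "?f x * g x + - (?f (\<phi> x) * g x) =
        2 * b * indicator {x. sign_pm (L x) \<noteq> sign_pm (L (\<phi> x))} x" if x: "x \<in> cube d" for x
    proof -
      consider "g x = 0" | "g x > 0" | "g x < 0" by linarith
      then show ?thesis
      proof cases
        case 1
        with L[OF x] show ?thesis by simp
      next
        case 2
        then have "L (\<phi> x) \<le> L x" "g x = b"
          using L[OF x] val[OF x] mult_nonneg_nonneg[OF \<open>0 \<le> c\<close>, of "g x"] by linarith+
        then show ?thesis by (auto simp: sign_pm_def)
      next
        case 3
        then have "L x \<le> L (\<phi> x)" "g x = - b"
          using L[OF x] val[OF x] mult_nonneg_nonpos[OF \<open>0 \<le> c\<close>, of "g x"] by linarith+
        then show ?thesis by (auto simp: sign_pm_def)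
      qed
    qed
    then show "AE x in measure_pmf (pmf_of_set (cube d)). ?f x * g x + - (?f (\<phi> x) * g x) =
        2 * b * indicator {x. sign_pm (L x) \<noteq> sign_pm (L (\<phi> x))} x"
      by (auto simp: AE_measure_pmf_iff)
  qed auto
  finally show ?thesis by simp
qed

lemma sign_pm_mult_self: "real_of_int (sign_pm r) * r = \<bar>r\<bar>"
  by (simp add: sign_pm_def)

lemma sign_pm_cases: "sign_pm r = 1 \<or> sign_pm r = - 1"
  by (simp add: sign_pm_def)

section \<open>Flipping one coordinate and exchanging two coordinates\<close>

lemma sum_mult_fun_upd:
  fixes v :: "nat \<Rightarrow> real" and x :: "nat \<Rightarrow> int"
  assumes "i \<in> {1..d}"
  shows "(\<Sum>l = 1..d. v l * (x(i := a)) l) = (\<Sum>l = 1..d. v l * x l) + v i * (a - x i)"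
proof -
  have "(\<Sum>l = 1..d. v l * (x(i := a)) l) = 
      (\<Sum>l = 1..d. v l * x l + (if l = i then v i * (a - x i) else 0))"
    by (intro sum.cong) (auto simp: algebra_simps)
  with assms show ?thesis by (simp add: sum.distrib)
qed

text \<open>Taking for \<open>\<phi>\<close> the flip of coordinate \<open>i\<close>, the product of
  the sign of \<open>v i\<close> with the Chow parameter is the probability that this flip changes
  the halfspace, that is, the influence of \<open>i\<close>. Hence it is nonnegative.\<close>

lemma chow_sign:
  assumes "i \<in> {1..d}"
  shows "sign_pm (v i) * chow d v \<tau> i = \<bar>chow d v \<tau> i\<bar>"
proof -
  let ?L = "\<lambda>x. (\<Sum>l = 1..d. v l * real_of_int (x l)) + \<tau>"
  let ?s = "real_of_int (sign_pm (v i))"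
  have "measure_pmf.expectation (pmf_of_set (cube d)) (\<lambda>x. sign_pm (?L x) * (?s * real_of_int (x i))) =
    1 * measure_pmf.prob (pmf_of_set (cube d)) {x. sign_pm (?L x) \<noteq> sign_pm (?L (x(i := - x i)))}"
  proof (rule expectation_sign_times_odd[where c = "2 * \<bar>v i\<bar>"])
    fix x assume x: "x \<in> cube d"
    show "x(i := - x i) \<in> cube d"
      by (rule cube_fun_upd[OF x assms]) (use cube_coord[OF x assms] in auto)
    show "?L x - ?L (x(i := - x i)) = 2 * \<bar>v i\<bar> * (?s * real_of_int (x i))"
      unfolding sum_mult_fun_upd[OF assms] using sign_pm_mult_self[of "v i"]
      by (auto simp: sign_pm_def algebra_simps)
    show "\<bar>?s * real_of_int (x i)\<bar> = 0 \<or> \<bar>?s * real_of_int (x i)\<bar> = 1"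
      using cube_coord[OF x assms] by (auto simp: abs_mult sign_pm_def)
  qed auto
  moreover have "measure_pmf.expectation (pmf_of_set (cube d)) (\<lambda>x. sign_pm (?L x) * (?s * real_of_int (x i)))
      = ?s * chow d v \<tau> i"
    unfolding chow_def halfspace_def
    by (subst Bochner_Integration.integral_mult_right_zero[symmetric]) (simp add: mult_ac)
  ultimately have "?s * chow d v \<tau> i =
      measure_pmf.prob (pmf_of_set (cube d)) {x. sign_pm (?L x) \<noteq> sign_pm (?L (x(i := - x i)))}"
    by (simp only: mult_1)
  then have "0 \<le> ?s * chow d v \<tau> i" by (simp only: measure_nonneg)
  then show ?thesis by (auto simp: sign_pm_def split: if_splits)
qed

text \<open>Polymorphic because it acts on points of the cube and on coefficient vectors alike. With
  \<open>s\<close> the product of the signs of the two coefficients, the absolute values trade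
  places while each position keeps its sign.\<close>

definition signed_swap :: "'a::times \<Rightarrow> nat \<Rightarrow> nat \<Rightarrow> (nat \<Rightarrow> 'a) \<Rightarrow> nat \<Rightarrow> 'a" where
  "signed_swap s i j x = x(i := s * x j, j := s * x i)"

lemma signed_swap_cube:
  assumes "i \<in> {1..d}" "j \<in> {1..d}" "i \<noteq> j" "s = 1 \<or> s = - 1" "x \<in> cube d"
  shows "signed_swap s i j x \<in> cube d" and "signed_swap s i j (signed_swap s i j x) = x"
proof -
  show "signed_swap s i j x \<in> cube d"
    unfolding signed_swap_def using assms(4) cube_coord[OF assms(5,1)] cube_coord[OF assms(5,2)]
    by (intro cube_fun_upd assms) auto
  show "signed_swap s i j (signed_swap s i j x) = x"
    using assms by (auto simp: signed_swap_def fun_eq_iff)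
qed

lemma sum_signed_swap:
  fixes v :: "nat \<Rightarrow> real" and x :: "nat \<Rightarrow> int"
  assumes "i \<in> {1..d}" "j \<in> {1..d}" "i \<noteq> j"
  shows "(\<Sum>l = 1..d. v l * signed_swap s i j x l) =
    (\<Sum>l = 1..d. v l * x l) + v i * (s * x j - x i) + v j * (s * x i - x j)"
  unfolding signed_swap_def sum_mult_fun_upd[OF assms(2)] sum_mult_fun_upd[OF assms(1)] using assms by simp

text \<open>The signed swap is a symmetric linear map, so in the scalar product it can be moved from
  the point to the coefficient vector.\<close>

lemma halfspace_signed_swap:
  assumes "i \<in> {1..d}" "j \<in> {1..d}" "i \<noteq> j"
  shows "halfspace d w \<tau> (signed_swap s i j x) = halfspace d (signed_swap (real_of_int s) i j w) \<tau> x"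
proof -
  have "(\<Sum>l = 1..d. w l * signed_swap s i j x l) = (\<Sum>l = 1..d. signed_swap (real_of_int s) i j w l * x l)"
  proof -
    have "(\<Sum>l = 1..d. signed_swap (real_of_int s) i j w l * x l) =
        (\<Sum>l = 1..d. w l * x l + (if l = i then (s * w j - w i) * x i else 0)
          + (if l = j then (s * w i - w j) * x j else 0))"
      using assms by (intro sum.cong) (auto simp: signed_swap_def algebra_simps)
    also have "\<dots> = (\<Sum>l = 1..d. w l * x l) + (s * w j - w i) * x i + (s * w i - w j) * x j"
      using assms by (simp add: sum.distrib)
    finally show ?thesis
      by (simp only: sum_signed_swap[OF assms]) (simp add: algebra_simps)
  qed
  then show ?thesis by (simp add: halfspace_def)
qed

text \<open>The pairing argument is applied with the signed swap as \<open>\<phi>\<close> and with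
  g(x) = \<sigma>(i) x(i) - \<sigma>(j) x(j), where \<sigma>(l) is the sign of \<open>v l\<close>.
  This g has values 0, 2 and -2, the swap negates it, and the linear form changes by
  (\<open>\<bar>v i\<bar> - \<bar>v j\<bar>\<close>) times g. By \<open>chow_sign\<close> the
  expectation is the difference of the absolute Chow parameters.\<close>

lemma prob_signed_swap:
  assumes ij: "i \<in> {1..d}" "j \<in> {1..d}" "i \<noteq> j" and le: "\<bar>v j\<bar> \<le> \<bar>v i\<bar>"
    and s: "s = sign_pm (v i) * sign_pm (v j)"
  shows "2 * measure_pmf.prob (pmf_of_set (cube d))
      {x. halfspace d v \<tau> x \<noteq> halfspace d v \<tau> (signed_swap s i j x)} =
    \<bar>chow d v \<tau> i\<bar> - \<bar>chow d v \<tau> j\<bar>"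
proof -
  let ?L = "\<lambda>x. (\<Sum>l = 1..d. v l * real_of_int (x l)) + \<tau>"
  let ?\<sigma> = "\<lambda>l. real_of_int (sign_pm (v l))"
  let ?g = "\<lambda>x::nat \<Rightarrow> int. ?\<sigma> i * real_of_int (x i) - ?\<sigma> j * real_of_int (x j)"
  let ?E = "measure_pmf.expectation (pmf_of_set (cube d))"
  have s1: "s = 1 \<or> s = - 1" by (auto simp: s sign_pm_def)
  have "?E (\<lambda>x. sign_pm (?L x) * ?g x) =
    2 * measure_pmf.prob (pmf_of_set (cube d)) {x. sign_pm (?L x) \<noteq> sign_pm (?L (signed_swap s i j x))}"
  proof (rule expectation_sign_times_odd[where c = "\<bar>v i\<bar> - \<bar>v j\<bar>"])
    fix x assume x: "x \<in> cube d"
    show "signed_swap s i j x \<in> cube d" "signed_swap s i j (signed_swap s i j x) = x"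
      using signed_swap_cube[OF ij s1 x] by auto
    show "?g (signed_swap s i j x) = - ?g x"
      using ij sign_pm_cases[of "v i"] sign_pm_cases[of "v j"]
      by (elim disjE) (simp_all add: signed_swap_def s)
    show "?L x - ?L (signed_swap s i j x) = (\<bar>v i\<bar> - \<bar>v j\<bar>) * ?g x"
      unfolding sum_signed_swap[OF ij] s sign_pm_mult_self[symmetric]
      using sign_pm_cases[of "v i"] sign_pm_cases[of "v j"]
      by (elim disjE) (simp_all add: algebra_simps)
    show "\<bar>?g x\<bar> = 0 \<or> \<bar>?g x\<bar> = 2"
      using cube_coord[OF x ij(1)] cube_coord[OF x ij(2)]
        sign_pm_cases[of "v i"] sign_pm_cases[of "v j"]
      by (elim disjE) simp_all
  qed (use le in auto)
  moreover have "?E (\<lambda>x. sign_pm (?L x) * ?g x) = ?\<sigma> i * chow d v \<tau> i - ?\<sigma> j * chow d v \<tau> j"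
  proof -
    have "?\<sigma> i * chow d v \<tau> i - ?\<sigma> j * chow d v \<tau> j =
        ?E (\<lambda>x. ?\<sigma> i * real_of_int (sign_pm (?L x) * x i) - ?\<sigma> j * real_of_int (sign_pm (?L x) * x j))"
      unfolding chow_def halfspace_def
      by (subst Bochner_Integration.integral_diff) auto
    also have "\<dots> = ?E (\<lambda>x. sign_pm (?L x) * ?g x)"
      by (rule arg_cong[where f = ?E]) (auto simp: algebra_simps)
    finally show ?thesis by simp
  qed
  ultimately show ?thesis
    using chow_sign[OF ij(1), of v \<tau>] chow_sign[OF ij(2), of v \<tau>]
    unfolding halfspace_def by linarith
qed

section \<open>From single exchanges to a vector with prescribed largest indices\<close>

lemma prob_neq_triangle:
  "measure_pmf.prob p {x. f x \<noteq> h x} \<le>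
     measure_pmf.prob p {x. f x \<noteq> g x} + measure_pmf.prob p {x. g x \<noteq> h x}"
proof -
  have "measure_pmf.prob p {x. f x \<noteq> h x} \<le> measure_pmf.prob p ({x. f x \<noteq> g x} \<union> {x. g x \<noteq> h x})"
    by (rule measure_pmf.finite_measure_mono) auto
  also have "\<dots> \<le> measure_pmf.prob p {x. f x \<noteq> g x} + measure_pmf.prob p {x. g x \<noteq> h x}"
    by (rule measure_Un_le) auto
  finally show ?thesis .
qed

text \<open>The pairs \<open>i\<close>, \<open>h i\<close> are exchanged one after the other. As
  they are disjoint, every exchange still finds the original absolute values at its two positions.
  Only absolute values of \<open>w\<close> are recorded, which is all that
  \<open>largest_coeffs_at\<close> looks at.\<close>

lemma exists_swapped_vector:
  assumes "finite F" "inj_on h F" "F \<inter> h ` F = {}" "F \<union> h ` F \<subseteq> {1..d}"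
    and "\<And>i. i \<in> F \<Longrightarrow> \<bar>v (h i)\<bar> \<le> \<bar>v i\<bar>"
    and "\<And>i. i \<in> F \<Longrightarrow> \<bar>chow d v \<tau> i\<bar> - \<bar>chow d v \<tau> (h i)\<bar> \<le> 2 * \<epsilon>"
  obtains w where "\<And>i. i \<in> F \<Longrightarrow> \<bar>w i\<bar> = \<bar>v (h i)\<bar> \<and> \<bar>w (h i)\<bar> = \<bar>v i\<bar>"
    and "\<And>l. l \<notin> F \<union> h ` F \<Longrightarrow> \<bar>w l\<bar> = \<bar>v l\<bar>"
    and "measure_pmf.prob (pmf_of_set (cube d)) {x. halfspace d v \<tau> x \<noteq> halfspace d w \<tau> x} \<le> \<epsilon> * card F"
proof -
  have "\<exists>w. (\<forall>i\<in>F. \<bar>w i\<bar> = \<bar>v (h i)\<bar> \<and> \<bar>w (h i)\<bar> = \<bar>v i\<bar>) \<and>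
    (\<forall>l. l \<notin> F \<union> h ` F \<longrightarrow> \<bar>w l\<bar> = \<bar>v l\<bar>) \<and>
    measure_pmf.prob (pmf_of_set (cube d)) {x. halfspace d v \<tau> x \<noteq> halfspace d w \<tau> x} \<le> \<epsilon> * card F"
    using assms
  proof (induction F rule: finite_induct)
    case empty
    then show ?case by (intro exI[of _ v]) auto
  next
    case (insert i F)
    let ?P = "measure_pmf.prob (pmf_of_set (cube d))"
    from insert.IH insert.prems obtain w where w: "\<forall>i\<in>F. \<bar>w i\<bar> = \<bar>v (h i)\<bar> \<and> \<bar>w (h i)\<bar> = \<bar>v i\<bar>"
      "\<forall>l. l \<notin> F \<union> h ` F \<longrightarrow> \<bar>w l\<bar> = \<bar>v l\<bar>"
      "?P {x. halfspace d v \<tau> x \<noteq> halfspace d w \<tau> x} \<le> \<epsilon> * card F"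
      by auto
    define s where "s = sign_pm (v i) * sign_pm (v (h i))"
    have s1: "s = 1 \<or> s = - 1" by (auto simp: s_def sign_pm_def)
    have ij: "i \<in> {1..d}" "h i \<in> {1..d}" "i \<noteq> h i" using insert.prems by auto
    define \<phi> where "\<phi> = signed_swap s i (h i)"
    define w' where "w' = signed_swap (real_of_int s) i (h i) w"
    have w': "halfspace d w' \<tau> x = halfspace d w \<tau> (\<phi> x)" for x
      unfolding w'_def \<phi>_def by (rule halfspace_signed_swap[OF ij, symmetric])
    have out: "i \<notin> F \<union> h ` F" "h i \<notin> F \<union> h ` F"
      using insert.prems insert.hyps by (auto simp: inj_on_def)
    have out': "i' \<noteq> i \<and> i' \<noteq> h i \<and> h i' \<noteq> i \<and> h i' \<noteq> h i" if "i' \<in> F" for i'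
      using that out by (metis UnI1 UnI2 imageI)
    \<comment> \<open>The intermediate function is the original halfspace composed with
      \<open>\<phi>\<close>, not the current one. Thus the new exchange is charged to
      \<open>v\<close>, and no Chow parameters of \<open>w\<close> are needed.\<close>
    have "?P {x. halfspace d v \<tau> x \<noteq> halfspace d w' \<tau> x} \<le>
        ?P {x. halfspace d v \<tau> x \<noteq> halfspace d v \<tau> (\<phi> x)} +
        ?P {x. halfspace d v \<tau> (\<phi> x) \<noteq> halfspace d w \<tau> (\<phi> x)}"
      unfolding w' by (rule prob_neq_triangle)
    also have "?P {x. halfspace d v \<tau> x \<noteq> halfspace d v \<tau> (\<phi> x)} \<le> \<epsilon>"
      using prob_signed_swap[OF ij _ s_def, where \<tau> = \<tau>] insert.prems(4,5)[of i] by (simp add: \<phi>_def)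
    also have "?P {x. halfspace d v \<tau> (\<phi> x) \<noteq> halfspace d w \<tau> (\<phi> x)} =
        measure_pmf.prob (map_pmf \<phi> (pmf_of_set (cube d))) {x. halfspace d v \<tau> x \<noteq> halfspace d w \<tau> x}"
      by (simp add: vimage_def)
    \<comment> \<open>Both functions in the second term are composed with the same
      \<open>\<phi>\<close>, which preserves the uniform distribution; what remains is the error
      accumulated before.\<close>
    also have "map_pmf \<phi> (pmf_of_set (cube d)) = pmf_of_set (cube d)"
      unfolding \<phi>_def by (intro map_pmf_cube_involution signed_swap_cube[OF ij s1])
    also note w(3)
    finally have "?P {x. halfspace d v \<tau> x \<noteq> halfspace d w' \<tau> x} \<le> \<epsilon> * card (insert i F)"
      using insert.hyps by (simp add: algebra_simps)
    moreover have "\<bar>w' l\<bar> = (if l = i then \<bar>v (h i)\<bar> else if l = h i then \<bar>v i\<bar> else \<bar>w l\<bar>)" for l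
      using w(2) out s1 ij by (auto simp: w'_def signed_swap_def abs_mult)
    moreover from this have "\<forall>i'\<in>insert i F. \<bar>w' i'\<bar> = \<bar>v (h i')\<bar> \<and> \<bar>w' (h i')\<bar> = \<bar>v i'\<bar>"
      using w(1) out' ij(3) by auto
    ultimately show ?case
      using w(2) by (intro exI[of _ w']) auto
  qed
  then show thesis by (elim exE conjE) (rule that, simp_all)
qed

text \<open>Greedy choice: a largest coefficient outside the current set is added until
  \<open>k\<close> indices are found.\<close>

lemma exists_largest_coeffs:
  assumes "k \<le> d"
  obtains S where "S \<subseteq> {1..d}" "card S = k" "largest_coeffs_at d v S"
proof -
  have "\<exists>S \<subseteq> {1..d}. card S = k \<and> largest_coeffs_at d v S"
    using assms
  proof (induction k)
    case 0
    then show ?case by (intro exI[of _ "{}"]) (auto simp: largest_coeffs_at_def)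
  next
    case (Suc k)
    then obtain S where S: "S \<subseteq> {1..d}" "card S = k" "largest_coeffs_at d v S" by auto
    have fin: "finite S" using S(1) finite_subset by blast
    have "{1..d} - S \<noteq> {}"
      using card_mono[OF fin, of "{1..d}"] S(2) Suc.prems by auto
    then have "Max ((\<lambda>i. \<bar>v i\<bar>) ` ({1..d} - S)) \<in> (\<lambda>i. \<bar>v i\<bar>) ` ({1..d} - S)"
      by (intro Max_in) auto
    then obtain b where b: "b \<in> {1..d} - S" "Max ((\<lambda>i. \<bar>v i\<bar>) ` ({1..d} - S)) = \<bar>v b\<bar>"
      by blast
    have "\<bar>v i\<bar> \<le> \<bar>v b\<bar>" if "i \<in> {1..d} - S" for i
      unfolding b(2)[symmetric] using that by (intro Max_ge) auto
    with S b(1) fin show ?case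
      by (intro exI[of _ "insert b S"]) (auto simp: largest_coeffs_at_def)
  qed
  then show thesis using that by blast
qed

text \<open>Let \<open>S\<close> hold the \<open>k\<close> largest coefficients of \<open>v\<close>.
  The sets \<open>S - J\<close> and \<open>J - S\<close> have equal size, and a bijection between
  them says which coefficients to exchange. Afterwards \<open>w\<close> has on \<open>J\<close> only
  absolute values that \<open>v\<close> has on \<open>S\<close>, and off \<open>J\<close> only those
  that \<open>v\<close> has off \<open>S\<close>.\<close>

lemma exists_vector_with_largest_coeffs:
  assumes J: "J \<subseteq> {1..d}" "card J = k" and \<epsilon>: "0 \<le> \<epsilon>"
    and chow: "\<And>i j. j \<in> J \<Longrightarrow> i \<in> {1..d} - J \<Longrightarrow> \<bar>chow d v \<tau> i\<bar> - \<bar>chow d v \<tau> j\<bar> \<le> 2 * \<epsilon>"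
  obtains w where "largest_coeffs_at d w J"
    "measure_pmf.prob (pmf_of_set (cube d)) {x. halfspace d v \<tau> x \<noteq> halfspace d w \<tau> x} \<le> \<epsilon> * k"
proof -
  have finJ: "finite J" using J(1) finite_subset by blast
  have "k \<le> d" using card_mono[OF _ J(1)] J(2) by simp
  then obtain S where S: "S \<subseteq> {1..d}" "card S = k" "largest_coeffs_at d v S"
    by (rule exists_largest_coeffs)
  have finS: "finite S" using S(1) finite_subset by blast
  have "card (S - J) = card (J - S)"
    using card_Diff_subset_Int[of S J] card_Diff_subset_Int[of J S] finS finJ S(2) J(2)
    by (simp add: Int_commute)
  then obtain h where h: "bij_betw h (S - J) (J - S)"
    using finite_same_card_bij[OF finite_Diff[OF finS] finite_Diff[OF finJ]] by blast
  have hJ: "h i \<in> J - S" if "i \<in> S - J" for i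
    using bij_betw_apply[OF h that] .
  have top: "\<bar>v j\<bar> \<le> \<bar>v i\<bar>" if "i \<in> S" "j \<in> {1..d} - S" for i j
    using S(3) that unfolding largest_coeffs_at_def by blast
  have img: "h ` (S - J) = J - S" using h by (simp add: bij_betw_def)
  obtain w where w: "\<And>i. i \<in> S - J \<Longrightarrow> \<bar>w i\<bar> = \<bar>v (h i)\<bar> \<and> \<bar>w (h i)\<bar> = \<bar>v i\<bar>"
    "\<And>l. l \<notin> (S - J) \<union> h ` (S - J) \<Longrightarrow> \<bar>w l\<bar> = \<bar>v l\<bar>"
    "measure_pmf.prob (pmf_of_set (cube d)) {x. halfspace d v \<tau> x \<noteq> halfspace d w \<tau> x} \<le> \<epsilon> * card (S - J)"
  proof (rule exists_swapped_vector[of "S - J" h d v \<tau> \<epsilon>])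
    show "inj_on h (S - J)" using h by (simp add: bij_betw_def)
    show "(S - J) \<inter> h ` (S - J) = {}" "(S - J) \<union> h ` (S - J) \<subseteq> {1..d}"
      using S J by (auto simp: img)
    fix i assume i: "i \<in> S - J"
    show "\<bar>v (h i)\<bar> \<le> \<bar>v i\<bar>" by (rule top) (use hJ[OF i] i J(1) in blast)+
    show "\<bar>chow d v \<tau> i\<bar> - \<bar>chow d v \<tau> (h i)\<bar> \<le> 2 * \<epsilon>" 
      by (rule chow) (use hJ[OF i] i S(1) in blast)+
  qed (use finS in auto)
  have inJ: "\<exists>i'\<in>S. \<bar>w i\<bar> = \<bar>v i'\<bar>" if "i \<in> J" for i
  proof (cases "i \<in> S")
    case True
    with w(2)[of i] img that show ?thesis by auto
  next
    case False
    then have "i \<in> h ` (S - J)" using that img by simp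
    then obtain i' where "i' \<in> S - J" "i = h i'" by (rule imageE)
    with w(1)[of i'] show ?thesis by auto
  qed
  have notinJ: "\<exists>j'\<in>{1..d} - S. \<bar>w j\<bar> = \<bar>v j'\<bar>" if "j \<in> {1..d} - J" for j
  proof (cases "j \<in> S")
    case True
    with that have "j \<in> S - J" by simp
    with hJ[OF this] w(1)[of j] J(1) show ?thesis by (intro bexI[of _ "h j"]) auto
  next
    case False
    with w(2)[of j] img that show ?thesis by auto
  qed
  have "largest_coeffs_at d w J"
    unfolding largest_coeffs_at_def
  proof (intro ballI)
    fix i j assume "i \<in> J" "j \<in> {1..d} - J"
    with inJ notinJ obtain i' j' where "i' \<in> S" "\<bar>w i\<bar> = \<bar>v i'\<bar>" "j' \<in> {1..d} - S" "\<bar>w j\<bar> = \<bar>v j'\<bar>"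
      by blast
    with top show "\<bar>w j\<bar> \<le> \<bar>w i\<bar>" by simp
  qed
  moreover have "\<epsilon> * card (S - J) \<le> \<epsilon> * k"
    using card_mono[OF finS, of "S - J"] S(2) \<epsilon> by (intro mult_left_mono) auto
  ultimately show thesis using w(3) that by (meson order_trans)
qed

section \<open>Estimation from samples\<close>

lemma expectation_bind_pmf_finite:
  fixes h :: "'b \<Rightarrow> real"
  assumes "finite (set_pmf p)" "\<And>x. x \<in> set_pmf p \<Longrightarrow> finite (set_pmf (f x))"
  shows "measure_pmf.expectation (bind_pmf p f) h =
    measure_pmf.expectation p (\<lambda>x. measure_pmf.expectation (f x) h)"
proof -
  have "measure_pmf.expectation (bind_pmf p f) h =
      (\<Sum>x\<in>set_pmf p. pmf p x *\<^sub>R measure_pmf.expectation (f x) h)"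
    by (rule pmf_expectation_bind) (use assms in auto)
  also have "\<dots> = measure_pmf.expectation p (\<lambda>x. measure_pmf.expectation (f x) h)"
    by (rule integral_measure_pmf[symmetric]) (use assms in auto)
  finally show ?thesis .
qed

lemma finite_set_replicate_pmf: "finite (set_pmf p) \<Longrightarrow> finite (set_pmf (replicate_pmf n p))"
  using finite_lists_length_eq[of "set_pmf p" n] by (auto simp: set_replicate_pmf lists_eq_set)

lemma expectation_replicate_pmf_Suc:
  fixes h :: "'a list \<Rightarrow> real"
  assumes "finite (set_pmf p)"
  shows "measure_pmf.expectation (replicate_pmf (Suc n) p) h =
    measure_pmf.expectation p (\<lambda>x. measure_pmf.expectation (replicate_pmf n p) (\<lambda>xs. h (x # xs)))"
proof -
  have "replicate_pmf (Suc n) p = bind_pmf p (\<lambda>x. map_pmf ((#) x) (replicate_pmf n p))"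
    by (simp add: map_pmf_def)
  then show ?thesis
    using assms by (simp add: expectation_bind_pmf_finite finite_set_replicate_pmf)
qed

text \<open>Both claims are proved by one induction on the first sample. In the square of the sum,
  the cross term vanishes because the remaining sum has mean zero, which is the first claim.\<close>

lemma moments_sum_list_centered:
  fixes g :: "'a \<Rightarrow> real"
  assumes fin: "finite (set_pmf p)" and "measure_pmf.expectation p g = 0"
  shows "measure_pmf.expectation (replicate_pmf n p) (\<lambda>xs. \<Sum>x\<leftarrow>xs. g x) = 0"
    and "measure_pmf.expectation (replicate_pmf n p) (\<lambda>xs. (\<Sum>x\<leftarrow>xs. g x)\<^sup>2) =
      n * measure_pmf.expectation p (\<lambda>x. (g x)\<^sup>2)"
proof (induction n)
  case (Suc n)
  note [simp] = integrable_measure_pmf_finite[OF fin]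
    integrable_measure_pmf_finite[OF finite_set_replicate_pmf[OF fin]]
  let ?E = "measure_pmf.expectation (replicate_pmf n p)"
  { case 1
    show ?case
      unfolding expectation_replicate_pmf_Suc[OF fin] using assms Suc by simp }
  { case 2
    have "?E (\<lambda>xs. (\<Sum>y\<leftarrow>x # xs. g y)\<^sup>2) = (g x)\<^sup>2 + n * measure_pmf.expectation p (\<lambda>x. (g x)\<^sup>2)" for x
    proof -
      have "?E (\<lambda>xs. (\<Sum>y\<leftarrow>x # xs. g y)\<^sup>2) =
          ?E (\<lambda>xs. (g x)\<^sup>2 + 2 * g x * (\<Sum>y\<leftarrow>xs. g y) + (\<Sum>y\<leftarrow>xs. g y)\<^sup>2)"
        by (simp add: power2_sum algebra_simps)
      also have "\<dots> = (g x)\<^sup>2 + 2 * g x * ?E (\<lambda>xs. \<Sum>y\<leftarrow>xs. g y) + ?E (\<lambda>xs. (\<Sum>y\<leftarrow>xs. g y)\<^sup>2)"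
        by simp
      finally show ?thesis using Suc by simp
    qed
    then show ?case
      unfolding expectation_replicate_pmf_Suc[OF fin] by (simp add: algebra_simps) }
qed simp_all

text \<open>Chebyshev's inequality; the variance of one term is at most its second moment, hence at
  most 1.\<close>

lemma prob_empirical_deviation_le:
  fixes g :: "'a \<Rightarrow> real"
  assumes fin: "finite (set_pmf p)" and g: "\<And>x. x \<in> set_pmf p \<Longrightarrow> \<bar>g x\<bar> \<le> 1"
    and "0 < a" and "0 < n"
  shows "measure_pmf.prob (replicate_pmf n p)
    {xs. n * a \<le> \<bar>(\<Sum>x\<leftarrow>xs. g x) - n * measure_pmf.expectation p g\<bar>} \<le> 1 / (n * a\<^sup>2)"
proof -
  note [simp] = integrable_measure_pmf_finite[OF fin]
    integrable_measure_pmf_finite[OF finite_set_replicate_pmf[OF fin]]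
  define \<mu> where "\<mu> = measure_pmf.expectation p g"
  define h where "h = (\<lambda>x. g x - \<mu>)"
  have h0: "measure_pmf.expectation p h = 0"
    by (simp add: h_def \<mu>_def)
  have "measure_pmf.expectation p (\<lambda>x. (h x)\<^sup>2) =
      measure_pmf.expectation p (\<lambda>x. (g x)\<^sup>2) - \<mu>\<^sup>2"
    unfolding h_def \<mu>_def by (rule measure_pmf.variance_eq) auto
  also have "\<dots> \<le> measure_pmf.expectation p (\<lambda>x. 1)"
  proof -
    have "measure_pmf.expectation p (\<lambda>x. (g x)\<^sup>2) \<le> measure_pmf.expectation p (\<lambda>x. 1)"
      by (rule integral_mono_AE) (use g in \<open>auto simp: AE_measure_pmf_iff abs_square_le_1\<close>)
    then show ?thesis using zero_le_power2[of \<mu>] by linarith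
  qed
  finally have var: "measure_pmf.expectation p (\<lambda>x. (h x)\<^sup>2) \<le> 1" by simp
  \<comment> \<open>The two events agree on lists of length \<open>n\<close>, which carry all the
    mass, so the equality goes through almost sure equivalence.\<close>
  have "measure_pmf.prob (replicate_pmf n p)
      {xs. n * a \<le> \<bar>(\<Sum>x\<leftarrow>xs. g x) - n * \<mu>\<bar>} =
    measure_pmf.prob (replicate_pmf n p) {xs. n * a \<le> \<bar>\<Sum>x\<leftarrow>xs. h x\<bar>}"
    by (rule measure_pmf.finite_measure_eq_AE)
      (auto simp: AE_measure_pmf_iff set_replicate_pmf h_def sum_list_subtractf sum_list_triv)
  also have "\<dots> \<le> n * measure_pmf.expectation p (\<lambda>x. (h x)\<^sup>2) / (n * a)\<^sup>2"
    using measure_pmf.Chebyshev_inequality[of "\<lambda>xs. \<Sum>x\<leftarrow>xs. h x" "replicate_pmf n p" "n * a"]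
      moments_sum_list_centered[OF fin h0, of n] assms(3,4) by simp
  also have "\<dots> \<le> n * 1 / (n * a)\<^sup>2"
    using mult_left_mono[OF var, of "real n"] by (intro divide_right_mono) simp_all
  also have "\<dots> = 1 / (n * a\<^sup>2)"
    using assms(3,4) by (simp add: power2_eq_square)
  finally show ?thesis by (simp add: \<mu>_def)
qed

section \<open>The effect of corruption in total variation\<close>

lemma prob_diff_le_tv_dist:
  "\<bar>measure_pmf.prob p A - measure_pmf.prob q A\<bar> \<le> tv_dist p q"
  unfolding tv_dist_def
proof (rule cSUP_upper)
  have "\<bar>measure_pmf.prob p A - measure_pmf.prob q A\<bar> \<le> 1" for A
    using measure_pmf.prob_le_1[of p A] measure_pmf.prob_le_1[of q A]
      measure_nonneg[of p A] measure_nonneg[of q A] by linarith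
  then show "bdd_above (range (\<lambda>A. \<bar>measure_pmf.prob p A - measure_pmf.prob q A\<bar>))"
    by (intro bdd_aboveI2)
qed simp

text \<open>A function with values 1 and -1 has expectation 2 Pr[g = 1] - 1, whence the factor
  2.\<close>

lemma expectation_diff_le_tv_dist:
  assumes "\<And>x. x \<in> set_pmf p \<union> set_pmf q \<Longrightarrow> g x = 1 \<or> g x = - 1"
  shows "\<bar>measure_pmf.expectation p g - measure_pmf.expectation q g\<bar> \<le> 2 * tv_dist p q"
proof -
  have E: "measure_pmf.expectation r g = 2 * measure_pmf.prob r {x. g x = 1} - 1"
    if "set_pmf r \<subseteq> set_pmf p \<union> set_pmf q" for r
  proof -
    have "measure_pmf.expectation r g = measure_pmf.expectation r (\<lambda>x. 2 * indicator {x. g x = 1} x - 1)"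
      by (rule integral_cong_AE) (use that assms in \<open>force simp: AE_measure_pmf_iff indicator_def\<close>)+
    moreover have "integrable (measure_pmf r) (indicator {x. g x = 1} :: _ \<Rightarrow> real)"
      by (rule integrable_real_indicator) (auto simp: less_top[symmetric])
    ultimately show ?thesis by simp
  qed
  show ?thesis
    using E[of p] E[of q] prob_diff_le_tv_dist[of p "{x. g x = 1}" q] by simp
qed

definition inverse_ceiling :: "real \<Rightarrow> nat" where
  "inverse_ceiling \<eta> = nat \<lceil>1 / \<eta>\<rceil>"

text \<open>The factor 64 makes the union bound over \<open>d\<close> coordinates come out as 1/256,
  below the allowed 0.005; as a power of two it is reached by six doublings.\<close>

definition num_samples :: "nat \<Rightarrow> real \<Rightarrow> nat" where
  "num_samples d \<eta> = 64 * d * (inverse_ceiling \<eta>)\<^sup>2"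

text \<open>On labels 1 and -1 this is the sum of y x(i), the list length times the empirical Chow
  parameter. The case distinction mirrors the program, which cannot multiply.\<close>

definition correlation :: "example list \<Rightarrow> nat \<Rightarrow> int" where
  "correlation \<omega> i = (\<Sum>(x, y)\<leftarrow>\<omega>. if y < 0 then - x i else x i)"

definition top_set :: "nat \<Rightarrow> (nat \<Rightarrow> int) \<Rightarrow> nat set \<Rightarrow> bool" where
  "top_set d A J \<longleftrightarrow> J \<subseteq> {1..d} \<and> (\<forall>i\<in>J. \<forall>j\<in>{1..d} - J. A j \<le> A i)"

text \<open>The first claim describes the ceiling by the very comparison with which
  \<open>invert_eta\<close> decides whether to go on.\<close>

lemma inverse_ceiling_bounds:
  assumes "0 < \<eta>" and "\<eta> < 1"
  shows "j < inverse_ceiling \<eta> \<longleftrightarrow> real j * \<eta> < 1"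
    and "1 \<le> real (inverse_ceiling \<eta>) * \<eta>" and "1 \<le> inverse_ceiling \<eta>" and "real (inverse_ceiling \<eta>) \<le> 2 / \<eta>"
proof -
  have "j < inverse_ceiling \<eta> \<longleftrightarrow> real j < 1 / \<eta>" for j
    unfolding inverse_ceiling_def zless_nat_eq_int_zless less_ceiling_iff by simp
  then show *: "j < inverse_ceiling \<eta> \<longleftrightarrow> real j * \<eta> < 1" for j
    using assms by (simp add: field_simps)
  from *[of "inverse_ceiling \<eta>"] show "1 \<le> real (inverse_ceiling \<eta>) * \<eta>" by simp
  from *[of 0] show "1 \<le> inverse_ceiling \<eta>" by simp
  have "1 \<le> 1 / \<eta>" using assms by simp
  then have "real (inverse_ceiling \<eta>) \<le> 1 / \<eta> + 1"
    unfolding inverse_ceiling_def using ceiling_correct[of "1/\<eta>"] by linarith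
  with \<open>1 \<le> 1 / \<eta>\<close> show "real (inverse_ceiling \<eta>) \<le> 2 / \<eta>"
    by linarith
qed

definition label_coord :: "nat \<Rightarrow> example \<Rightarrow> real" where
  "label_coord i = (\<lambda>(x, y). real_of_int (if y < 0 then - x i else x i))"

lemma label_coord_pm1:
  "xy \<in> cube d \<times> B \<Longrightarrow> i \<in> {1..d} \<Longrightarrow> label_coord i xy = 1 \<or> label_coord i xy = - 1"
  using cube_coord[of "fst xy" d i] by (auto simp: label_coord_def split_def)

lemma real_correlation: "real_of_int (correlation \<omega> i) = (\<Sum>xy\<leftarrow>\<omega>. label_coord i xy)"
  by (induction \<omega>) (auto simp: correlation_def label_coord_def)

lemma expectation_label_coord:
  "measure_pmf.expectation (halfspace_pmf d v \<tau>) (label_coord i) = chow d v \<tau> i"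
proof -
  have "label_coord i (x, halfspace d v \<tau> x) = real_of_int (halfspace d v \<tau> x * x i)" for x
    by (cases "halfspace d v \<tau> x < 0") (auto simp: label_coord_def halfspace_def sign_pm_def)
  then show ?thesis by (simp add: halfspace_pmf_def chow_def)
qed

text \<open>The selection guarantees the right order of the absolute estimates; replacing both of
  them by the true values costs \<delta> each.\<close>

lemma chow_diff_le:
  assumes "top_set d (\<lambda>i. \<bar>correlation \<omega> i\<bar>) J" and "0 < m"
    and close: "\<And>i. i \<in> {1..d} \<Longrightarrow> \<bar>correlation \<omega> i - m * chow d v \<tau> i\<bar> \<le> m * \<delta>"
    and "j \<in> J" "i \<in> {1..d} - J"
  shows "\<bar>chow d v \<tau> i\<bar> - \<bar>chow d v \<tau> j\<bar> \<le> 2 * \<delta>"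
proof -
  have "j \<in> {1..d}" and "\<bar>correlation \<omega> i\<bar> \<le> \<bar>correlation \<omega> j\<bar>"
    using assms(1,4,5) unfolding top_set_def by blast+
  then have "\<bar>real_of_int (correlation \<omega> i)\<bar> \<le> \<bar>real_of_int (correlation \<omega> j)\<bar>"
    by linarith
  moreover have "\<bar>correlation \<omega> i - m * chow d v \<tau> i\<bar> \<le> m * \<delta>"
    "\<bar>correlation \<omega> j - m * chow d v \<tau> j\<bar> \<le> m * \<delta>"
    using \<open>j \<in> {1..d}\<close> assms(5) by (auto intro: close)
  then have "\<bar>m * chow d v \<tau> i\<bar> \<le> \<bar>correlation \<omega> i\<bar> + m * \<delta>"
    "\<bar>correlation \<omega> j\<bar> \<le> \<bar>m * chow d v \<tau> j\<bar> + m * \<delta>"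
    by linarith+
  ultimately have "\<bar>m * chow d v \<tau> i\<bar> - \<bar>m * chow d v \<tau> j\<bar> \<le> 2 * (m * \<delta>)"
    by linarith
  then have "m * (\<bar>chow d v \<tau> i\<bar> - \<bar>chow d v \<tau> j\<bar>) \<le> m * (2 * \<delta>)"
    using \<open>0 < m\<close> by (simp add: abs_mult algebra_simps)
  then show ?thesis using \<open>0 < m\<close> by simp
qed

lemma exists_vector_of_top_set:
  assumes top: "top_set d (\<lambda>i. \<bar>correlation \<omega> i\<bar>) J" "card J = k" and "0 < m" and "0 \<le> \<eta>"
    and close: "\<forall>i\<in>{1..d}. \<bar>correlation \<omega> i - real m * chow d v \<tau> i\<bar> \<le> real m * (4 * \<eta>)"
  obtains w where "largest_coeffs_at d w J" "measure_pmf.prob (pmf_of_set (cube d))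
       {x. halfspace d v \<tau> x \<noteq> halfspace d w \<tau> x} \<le> 4 * \<eta> * real k"
\<comment> \<open>Estimates accurate to 4\<eta> give a Chow gap of at most 8\<eta>, and an exchange
  costs half of the gap.\<close>
proof (rule exists_vector_with_largest_coeffs[of J d k "4 * \<eta>" v \<tau>])
  show "J \<subseteq> {1..d}" using top(1) by (simp add: top_set_def)
  fix i j assume "j \<in> J" "i \<in> {1..d} - J"
  then show "\<bar>chow d v \<tau> i\<bar> - \<bar>chow d v \<tau> j\<bar> \<le> 2 * (4 * \<eta>)"
    by (intro chow_diff_le[OF top(1), of "real m"]) (use close \<open>0 < m\<close> in auto)
qed (use assms that in simp_all)

text \<open>The tolerance 4\<eta> is split evenly: 2\<eta> for the bias caused by the corruption and
  2\<eta> for the sampling error. The latter is controlled by a union bound over the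
  coordinates.\<close>

lemma prob_correlation_close:
  assumes \<eta>: "0 < \<eta>" "\<eta> < 1" and "1 \<le> d" and supp: "set_pmf D \<subseteq> cube d \<times> {-1, 1}"
    and tv: "tv_dist D (halfspace_pmf d v \<tau>) \<le> \<eta>" and m: "m = num_samples d \<eta>"
  shows "measure_pmf.prob (replicate_pmf m D)
    {\<omega>. \<forall>i\<in>{1..d}. \<bar>correlation \<omega> i - m * chow d v \<tau> i\<bar> \<le> m * (4 * \<eta>)} \<ge> 0.995"
proof -
  have fin: "finite (set_pmf D)"
    by (rule finite_subset[OF supp]) auto
  have "1 \<le> real (inverse_ceiling \<eta>) * \<eta>" using inverse_ceiling_bounds(2)[OF \<eta>] .
  then have "1 \<le> (real (inverse_ceiling \<eta>) * \<eta>)\<^sup>2" by simp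
  then have "64 * real d * 1 \<le> 64 * real d * (real (inverse_ceiling \<eta>) * \<eta>)\<^sup>2"
    by (intro mult_left_mono) auto
  then have m_large: "64 * real d \<le> m * \<eta>\<^sup>2"
    by (simp add: m num_samples_def power_mult_distrib mult_ac)
  then have "0 < m" using \<open>1 \<le> d\<close> by (cases "m = 0") auto
  define \<mu> where "\<mu> i = measure_pmf.expectation D (label_coord i)" for i
  define Bad where "Bad i = {\<omega>. m * (2 * \<eta>) \<le> \<bar>(\<Sum>xy\<leftarrow>\<omega>. label_coord i xy) - m * \<mu> i\<bar>}" for i
  have \<mu>: "\<bar>\<mu> i - chow d v \<tau> i\<bar> \<le> 2 * \<eta>" if i: "i \<in> {1..d}" for i
  proof -
    have "\<bar>\<mu> i - chow d v \<tau> i\<bar> \<le> 2 * tv_dist D (halfspace_pmf d v \<tau>)"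
      unfolding \<mu>_def expectation_label_coord[symmetric]
    proof (rule expectation_diff_le_tv_dist)
      fix xy assume "xy \<in> set_pmf D \<union> set_pmf (halfspace_pmf d v \<tau>)"
      then have "xy \<in> cube d \<times> UNIV" using supp by (auto simp: halfspace_pmf_def)
      then show "label_coord i xy = 1 \<or> label_coord i xy = - 1" by (rule label_coord_pm1) (rule i)
    qed
    with tv show ?thesis by linarith
  qed
  have "measure_pmf.prob (replicate_pmf m D) (\<Union>i\<in>{1..d}. Bad i) \<le>
      (\<Sum>i\<in>{1..d}. measure_pmf.prob (replicate_pmf m D) (Bad i))"
    by (rule measure_pmf.finite_measure_subadditive_finite) auto
  also have "\<dots> \<le> (\<Sum>i\<in>{1..d}. 1 / (m * (2 * \<eta>)\<^sup>2))"
  proof (rule sum_mono)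
    fix i assume i: "i \<in> {1..d}"
    have "\<bar>label_coord i xy\<bar> \<le> 1" if "xy \<in> set_pmf D" for xy
      using label_coord_pm1[OF subsetD[OF supp that] i] by auto
    then show "measure_pmf.prob (replicate_pmf m D) (Bad i) \<le> 1 / (m * (2 * \<eta>)\<^sup>2)"
      unfolding Bad_def \<mu>_def using \<eta> \<open>0 < m\<close> by (intro prob_empirical_deviation_le[OF fin]) auto
  qed
  also have "\<dots> = d / (4 * (m * \<eta>\<^sup>2))"
    by (simp add: power_mult_distrib mult_ac)
  also have "\<dots> \<le> d / (4 * (64 * real d))"
    using m_large \<open>1 \<le> d\<close> \<open>0 < m\<close> \<eta> by (intro divide_left_mono mult_left_mono mult_pos_pos) auto
  also have "\<dots> \<le> 0.005" using \<open>1 \<le> d\<close> by simp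
  finally have bad: "measure_pmf.prob (replicate_pmf m D) (\<Union>i\<in>{1..d}. Bad i) \<le> 0.005" .
  have "1 - measure_pmf.prob (replicate_pmf m D) (\<Union>i\<in>{1..d}. Bad i) =
      measure_pmf.prob (replicate_pmf m D) (- (\<Union>i\<in>{1..d}. Bad i))"
    using measure_pmf.prob_compl[of "\<Union>i\<in>{1..d}. Bad i" "replicate_pmf m D"]
    by (simp add: Compl_eq_Diff_UNIV)
  also have "\<dots> \<le> measure_pmf.prob (replicate_pmf m D)
    {\<omega>. \<forall>i\<in>{1..d}. \<bar>correlation \<omega> i - m * chow d v \<tau> i\<bar> \<le> m * (4 * \<eta>)}"
  proof (rule measure_pmf.finite_measure_mono)
    show "- (\<Union>i\<in>{1..d}. Bad i) \<subseteq> {\<omega>. \<forall>i\<in>{1..d}. \<bar>correlation \<omega> i - m * chow d v \<tau> i\<bar> \<le> m * (4 * \<eta>)}"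
    proof (intro subsetI CollectI ballI)
      fix \<omega> i assume "\<omega> \<in> - (\<Union>i\<in>{1..d}. Bad i)" and i: "i \<in> {1..d}"
      then have "\<bar>correlation \<omega> i - m * \<mu> i\<bar> < m * (2 * \<eta>)"
        by (simp add: Bad_def real_correlation not_le)
      moreover have "\<bar>m * \<mu> i - m * chow d v \<tau> i\<bar> \<le> m * (2 * \<eta>)"
        using mult_left_mono[OF \<mu>[OF i], of m] by (simp add: abs_mult right_diff_distrib[symmetric])
      ultimately show "\<bar>correlation \<omega> i - m * chow d v \<tau> i\<bar> \<le> m * (4 * \<eta>)"
        by linarith
    qed
  qed simp
  finally show ?thesis using bad by simp
qed

section \<open>The algorithm\<close>

abbreviation ivar :: "vname \<Rightarrow> iexp" where
  "ivar a \<equiv> IArr a (IConst 0)"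

abbreviation iassign :: "vname \<Rightarrow> iexp \<Rightarrow> com" where
  "iassign a e \<equiv> ISet a (IConst 0) e"

abbreviation incr :: "vname \<Rightarrow> com" where
  "incr a \<equiv> iassign a (IAdd (ivar a) (IConst 1))"

abbreviation double :: "iexp \<Rightarrow> iexp" where
  "double e \<equiv> IAdd e e"

text \<open>Division by repeated addition: \<eta> is added up until the sum reaches 1, and
  \<open>N\<close> counts the additions.\<close>

definition invert_eta :: com where
  "invert_eta =
     Seq (iassign ''N'' (IConst 0)) (
     Seq (RSet ''r'' (IConst 0) (ROfInt (IConst 0))) (
     While (RLess (RArr ''r'' (IConst 0)) (ROfInt (IConst 1))) (
       Seq (RSet ''r'' (IConst 0) (RAdd (RArr ''r'' (IConst 0)) (RArr ''eta'' (IConst 0))))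
           (incr ''N''))))"

text \<open>Multiplication of the entry \<open>a\<close> by the value of \<open>e\<close>, from
  additions only.\<close>

definition add_repeatedly :: "vname \<Rightarrow> vname \<Rightarrow> iexp \<Rightarrow> com" where
  "add_repeatedly b a e =
     Seq (iassign b (IConst 0)) (
     Seq (iassign ''i'' (IConst 0)) (
     While (ILess (ivar ''i'') (ivar a)) (
       Seq (iassign b (IAdd (ivar b) e)) (incr ''i''))))"

definition accumulate :: com where
  "accumulate =
     While (ILess (IConst 0) (ivar ''m'')) (
       Seq (iassign ''m'' (ISub (ivar ''m'') (IConst 1))) (
       Seq Sample (
       Seq (iassign ''i'' (IConst 0)) (
       While (ILess (ivar ''i'') (ivar ''d'')) (
         Seq (incr ''i'') (
         Cond (ILess (ivar ''y'') (IConst 0))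
           (ISet ''a'' (ivar ''i'') (ISub (IArr ''a'' (ivar ''i'')) (IArr ''x'' (ivar ''i''))))
           (ISet ''a'' (ivar ''i'') (IAdd (IArr ''a'' (ivar ''i'')) (IArr ''x'' (ivar ''i''))))))))))"

definition absolute_values :: com where
  "absolute_values =
     Seq (iassign ''i'' (IConst 0)) (
     While (ILess (ivar ''i'') (ivar ''d'')) (
       Seq (incr ''i'') (
       Cond (ILess (IArr ''a'' (ivar ''i'')) (IConst 0))
         (ISet ''a'' (ivar ''i'') (ISub (IConst 0) (IArr ''a'' (ivar ''i''))))
         Skip)))"

text \<open>The caller sets \<open>b\<close> and \<open>i\<close> to 1, so that index 1 is the first
  candidate and the scan begins at index 2.\<close>

definition argmax :: com where
  "argmax =
     While (ILess (ivar ''i'') (ivar ''d'')) (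
       Seq (incr ''i'') (
       Cond (ILess (IArr ''a'' (ivar ''b'')) (IArr ''a'' (ivar ''i'')))
         (iassign ''b'' (ivar ''i''))
         Skip))"

text \<open>A selected entry is overwritten by \<open>-1\<close>, which is below every absolute value.\<close>

definition select_largest :: com where
  "select_largest =
     Seq (iassign ''l'' (IConst 0)) (
     While (ILess (ivar ''l'') (ivar ''k'')) (
       Seq (incr ''l'') (
       Seq (iassign ''b'' (IConst 1)) (
       Seq (iassign ''i'' (IConst 1)) (
       Seq argmax (
       Seq (ISet ''out'' (ivar ''l'') (ivar ''b''))
           (ISet ''a'' (ivar ''b'') (IConst (-1)))))))))"

text \<open>With N the ceiling of 1/\<eta>, the first three phases compute \<open>N\<close>, its
  square \<open>q\<close> and the sample size \<open>m\<close>, which is 64 \<open>d\<close> times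
  \<open>q\<close>.\<close>

definition heavy_coordinates :: com where
  "heavy_coordinates =
     Seq invert_eta (
     Seq (add_repeatedly ''q'' ''N'' (ivar ''N'')) (
     Seq (add_repeatedly ''m'' ''d''
       (double (double (double (double (double (double (ivar ''q'')))))))) (
     Seq accumulate (
     Seq absolute_values select_largest))))"

text \<open>The dominant phase is \<open>accumulate\<close>, with \<open>num_samples\<close> rounds
  of \<open>6 * d + 9\<close> steps; the constant generously absorbs all other phases.\<close>

definition time_bound :: "nat \<Rightarrow> real \<Rightarrow> nat" where
  "time_bound d \<eta> = 2000 * d\<^sup>2 * (inverse_ceiling \<eta>)\<^sup>2"

definition ready :: "nat \<Rightarrow> nat \<Rightarrow> state \<Rightarrow> bool" where
  "ready d k s \<longleftrightarrow> imem s ''d'' 0 = int d \<and> imem s ''k'' 0 = int k"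

text \<open>What the phases before the first draw preserve: parameters intact, correlation array
  still zero, no example drawn.\<close>

definition fresh :: "nat \<Rightarrow> nat \<Rightarrow> state \<Rightarrow> bool" where
  "fresh d k s \<longleftrightarrow> ready d k s \<and> imem s ''a'' = (\<lambda>_. 0) \<and> drawn s = 0"

lemma iset_select [simp]:
  "imem (iset a n z s) b = (if b = a then (imem s b)(n := z) else imem s b)"
  "rmem (iset a n z s) = rmem s" "drawn (iset a n z s) = drawn s"
  by (simp_all add: iset_def)

lemma rset_select [simp]:
  "rmem (rset a n r s) b = (if b = a then (rmem s b)(n := r) else rmem s b)"
  "imem (rset a n r s) = imem s" "drawn (rset a n r s) = drawn s"
  by (simp_all add: rset_def)

lemmas state_simps = ready_def fresh_def

section \<open>Polynomial growth of the time and sample bounds\<close>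

lemma poly_bounded_time_bound: "poly_bounded time_bound"
  unfolding poly_bounded_def
\<comment> \<open>The ceiling is at most 2/\<eta>, so squaring contributes a factor 4 to the 2000;
  for the sample bound, 64 likewise becomes 256.\<close>
proof (rule exI[of _ 8000], rule exI[of _ 2], rule exI[of _ 2], intro allI impI)
  fix d :: nat and \<eta> :: real
  assume "1 \<le> d" and \<eta>: "0 < \<eta> \<and> \<eta> < 1"
  have "(real (inverse_ceiling \<eta>))\<^sup>2 \<le> (2 / \<eta>)\<^sup>2"
    using inverse_ceiling_bounds(4) \<eta> by (intro power_mono) auto
  then have "2000 * (real d)\<^sup>2 * (real (inverse_ceiling \<eta>))\<^sup>2 \<le> 2000 * (real d)\<^sup>2 * (2 / \<eta>)\<^sup>2"
    by (intro mult_left_mono) auto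
  then show "real (time_bound d \<eta>) \<le> 8000 * (real d)\<^sup>2 * (1 / \<eta>)\<^sup>2"
    by (simp add: time_bound_def power_divide)
qed

lemma poly_bounded_num_samples: "poly_bounded num_samples"
  unfolding poly_bounded_def
proof (rule exI[of _ 256], rule exI[of _ 1], rule exI[of _ 2], intro allI impI)
  fix d :: nat and \<eta> :: real
  assume "1 \<le> d" and \<eta>: "0 < \<eta> \<and> \<eta> < 1"
  have "(real (inverse_ceiling \<eta>))\<^sup>2 \<le> (2 / \<eta>)\<^sup>2"
    using inverse_ceiling_bounds(4) \<eta> by (intro power_mono) auto
  then have "64 * real d * (real (inverse_ceiling \<eta>))\<^sup>2 \<le> 64 * real d * (2 / \<eta>)\<^sup>2"
    by (intro mult_left_mono) auto
  then show "real (num_samples d \<eta>) \<le> 256 * real d ^ 1 * (1 / \<eta>)\<^sup>2"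
    by (simp add: num_samples_def power_divide)
qed

\<comment> \<open>Correctness and running time of each phase\<close>
schematic_goal triple_invert_eta:
  assumes "0 < \<eta>" "\<eta> < 1" "fresh d k s" "rmem s ''eta'' 0 = \<eta>"
  shows "triple d D invert_eta s ?t 0
    (\<lambda>_ s'. fresh d k s' \<and> imem s' ''N'' 0 = int (inverse_ceiling \<eta>))" (is "triple _ _ _ _ _ _ ?Post")
proof -
  define I where "I j s' \<longleftrightarrow> fresh d k s' \<and> rmem s' ''eta'' 0 = \<eta> \<and>
    imem s' ''N'' 0 = int j \<and> rmem s' ''r'' 0 = real j * \<eta>" for j s'
  have "triple d D invert_eta s (inverse_ceiling \<eta> * (3 + 2) + 1 + 2 + 2) 0 (\<lambda>_. I (inverse_ceiling \<eta>))"
    unfolding invert_eta_def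
  proof (rule triple_ISet_Seq, rule triple_RSet_Seq, rule triple_While0)
    fix j s'
    assume "j < inverse_ceiling \<eta>" and I: "I j s'"
    then have "real j * \<eta> < 1" using inverse_ceiling_bounds(1) assms by blast
    moreover have "triple d D
        (Seq (RSet ''r'' (IConst 0) (RAdd (RArr ''r'' (IConst 0)) (RArr ''eta'' (IConst 0))))
        (incr ''N'')) s' (1 + 2) 0 (\<lambda>_. I (Suc j))"
      by (intro triple_RSet_Seq triple_ISet)
        (use I in \<open>simp add: I_def state_simps algebra_simps\<close>)
    ultimately show "bval (RLess (RArr ''r'' (IConst 0)) (ROfInt (IConst 1))) s' \<and> triple d D
        (Seq (RSet ''r'' (IConst 0) (RAdd (RArr ''r'' (IConst 0)) (RArr ''eta'' (IConst 0))))
        (incr ''N'')) s' 3 0 (\<lambda>_. I (Suc j))"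
      using I by (simp add: I_def numeral_3_eq_3)
  next
    fix s' assume "I (inverse_ceiling \<eta>) s'"
    then show "\<not> bval (RLess (RArr ''r'' (IConst 0)) (ROfInt (IConst 1))) s'"
      using inverse_ceiling_bounds(2)[OF assms(1,2)] by (simp add: I_def)
  qed (use assms in \<open>simp add: I_def state_simps\<close>)
  then show "triple d D invert_eta s (5 * inverse_ceiling \<eta> + 5) 0 ?Post"
    by (rule triple_weaken) (auto simp: I_def)
qed

\<comment> \<open>The third assumption says that \<open>e\<close> depends neither on the target
  \<open>b\<close> nor on the loop counter, so its value is the same in every round.\<close>
schematic_goal triple_add_repeatedly:
  assumes "fresh d k s" and "imem s a 0 = int n"
    and "\<And>s'. (\<forall>v. v \<noteq> b \<and> v \<noteq> ''i'' \<longrightarrow> imem s' v = imem s v) \<Longrightarrow> ival e s' = c"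
    and "a \<noteq> b" "a \<noteq> ''i''" "b \<noteq> ''i''" "b \<noteq> ''d''" "b \<noteq> ''k''" "b \<noteq> ''a''"
  shows "triple d D (add_repeatedly b a e) s ?t 0
    (\<lambda>_ s'. fresh d k s' \<and> imem s' b 0 = int n * c \<and>
       (\<forall>v. v \<noteq> b \<and> v \<noteq> ''i'' \<longrightarrow> imem s' v = imem s v))" (is "triple _ _ _ _ _ _ ?Post")
proof -
  define I where "I j s' \<longleftrightarrow> fresh d k s' \<and> imem s' ''i'' 0 = int j \<and> imem s' b 0 = int j * c \<and>
    (\<forall>v. v \<noteq> b \<and> v \<noteq> ''i'' \<longrightarrow> imem s' v = imem s v)" for j s'
  have "triple d D (add_repeatedly b a e) s (n * (3 + 2) + 1 + 2 + 2) 0 (\<lambda>_. I n)"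
    unfolding add_repeatedly_def
  proof (rule triple_ISet_Seq, rule triple_ISet_Seq, rule triple_While0)
    fix j s'
    assume j: "j < n" and I: "I j s'"
    have e: "ival e s' = c" using I assms(3)[of s'] by (simp add: I_def)
    have "triple d D (Seq (iassign b (IAdd (ivar b) e)) (incr ''i'')) s' (1 + 2) 0 (\<lambda>_. I (Suc j))"
      by (intro triple_ISet_Seq triple_ISet)
        (use I e assms(1,4-) in \<open>simp add: I_def state_simps algebra_simps\<close>)
    then show "bval (ILess (ivar ''i'') (ivar a)) s' \<and>
        triple d D (Seq (iassign b (IAdd (ivar b) e)) (incr ''i'')) s' 3 0 (\<lambda>_. I (Suc j))"
      using I assms(2,4,5) j by (simp add: I_def numeral_3_eq_3)
  next
    fix s' assume "I n s'"
    then show "\<not> bval (ILess (ivar ''i'') (ivar a)) s'"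
      using assms(2,4,5) by (simp add: I_def)
  qed (use assms in \<open>simp add: I_def state_simps\<close>)
  then show "triple d D (add_repeatedly b a e) s (5 * n + 5) 0 ?Post"
    by (rule triple_weaken) (auto simp: I_def)
qed

lemma correlation_Nil [simp]: "correlation [] i = 0"
  by (simp add: correlation_def)

schematic_goal triple_accumulate:
  assumes "ready d k s" "imem s ''m'' 0 = int m" "imem s ''a'' = (\<lambda>_. 0)" "drawn s = 0"
  shows "triple d D accumulate s ?t m
    (\<lambda>\<omega> s'. ready d k s' \<and> drawn s' = m \<and> (\<forall>i\<in>{1..d}. imem s' ''a'' i = correlation \<omega> i))" (is "triple _ _ _ _ _ _ ?Post")
proof -
  define I where "I j \<omega> s' \<longleftrightarrow> ready d k s' \<and> imem s' ''m'' 0 = int m - int j \<and> drawn s' = j \<and>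
    (\<forall>i\<in>{1..d}. imem s' ''a'' i = correlation \<omega> i)" for j and \<omega> :: "example list" and s'
  have "triple d D accumulate s (m * ((1 + 1 + (d * (1 + 1 + 2 + 2) + 1 + 2) + 2) + 2) + 1) (m * (1 + 0)) (I m)"
    unfolding accumulate_def
  proof (rule triple_While)
    fix j \<omega> s'
    assume j: "j < m" and I: "I j \<omega> s'"
    let ?add = "Cond (ILess (ivar ''y'') (IConst 0))
           (ISet ''a'' (ivar ''i'') (ISub (IArr ''a'' (ivar ''i'')) (IArr ''x'' (ivar ''i''))))
           (ISet ''a'' (ivar ''i'') (IAdd (IArr ''a'' (ivar ''i'')) (IArr ''x'' (ivar ''i''))))"
    let ?loop = "While (ILess (ivar ''i'') (ivar ''d'')) (Seq (incr ''i'') ?add)"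
    \<comment> \<open>At the start of the inner loop the counters \<open>m\<close> and
      \<open>drawn\<close> already account for the new example \<open>xy\<close>, whereas the array
      still holds the correlations of \<open>\<omega>\<close>.\<close>
    have loop: "triple d D ?loop s1 (d * (1 + 1 + 2 + 2) + 1) 0 (\<lambda>_. I (Suc j) (\<omega> @ [xy]))"
      if "I (Suc j) \<omega> s1" "imem s1 ''i'' 0 = 0" "imem s1 ''y'' 0 = snd xy"
        "\<forall>i\<in>{1..d}. imem s1 ''x'' i = fst xy i" for xy s1
    proof -
      \<comment> \<open>After \<open>n\<close> inner rounds, the first \<open>n\<close> entries
        include \<open>xy\<close> and the others do not yet.\<close>
      define I' where "I' n s2 \<longleftrightarrow> ready d k s2 \<and> imem s2 ''m'' 0 = int m - int (Suc j) \<and>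
        drawn s2 = Suc j \<and> imem s2 ''i'' 0 = int n \<and> imem s2 ''y'' 0 = snd xy \<and>
        (\<forall>i\<in>{1..d}. imem s2 ''x'' i = fst xy i) \<and>
        (\<forall>i\<in>{1..d}. imem s2 ''a'' i = correlation (if i \<le> n then \<omega> @ [xy] else \<omega>) i)" for n s2
      have "triple d D ?loop s1 (d * (1 + 1 + 2 + 2) + 1) 0 (\<lambda>_. I' d)"
      proof (rule triple_While0)
        fix n s2 assume n: "n < d" and I': "I' n s2"
        have "triple d D (Seq (incr ''i'') ?add) s2 (1 + 1 + 2) 0 (\<lambda>_. I' (Suc n))"
          by (intro triple_ISet_Seq triple_Cond triple_ISet;
              use I' n in \<open>auto simp: I'_def state_simps nat_add_distrib correlation_def split_def
                le_Suc_eq\<close>)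
        then show "bval (ILess (ivar ''i'') (ivar ''d'')) s2 \<and>
            triple d D (Seq (incr ''i'') ?add) s2 (1 + 1 + 2) 0 (\<lambda>_. I' (Suc n))"
          using I' n by (simp add: I'_def ready_def)
      next
        fix s2 assume "I' d s2"
        then show "\<not> bval (ILess (ivar ''i'') (ivar ''d'')) s2"
          by (simp add: I'_def ready_def)
      qed (use that in \<open>simp add: I_def I'_def\<close>)
      then show ?thesis by (rule triple_weaken) (auto simp: I_def I'_def)
    qed
    have "triple d D (Seq (iassign ''m'' (ISub (ivar ''m'') (IConst 1)))
        (Seq Sample (Seq (iassign ''i'' (IConst 0)) ?loop))) s'
        (1 + 1 + (d * (1 + 1 + 2 + 2) + 1 + 2) + 2) (1 + 0) (\<lambda>\<omega>'. I (Suc j) (\<omega> @ \<omega>'))"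
    proof (rule triple_ISet_Seq)
      let ?s = "iset ''m'' (nat (ival (IConst 0) s')) (ival (ISub (ivar ''m'') (IConst 1)) s') s'"
      show "triple d D (Seq Sample (Seq (iassign ''i'' (IConst 0)) ?loop)) ?s
        (1 + 1 + (d * (1 + 1 + 2 + 2) + 1 + 2)) (1 + 0) (\<lambda>\<omega>'. I (Suc j) (\<omega> @ \<omega>'))"
      proof (rule triple_Seq)
        show "triple d D Sample ?s 1 1 (\<lambda>\<omega>' s1. \<exists>xy. \<omega>' = [xy] \<and> I (Suc j) \<omega> s1 \<and>
            imem s1 ''y'' 0 = snd xy \<and> (\<forall>i\<in>{1..d}. imem s1 ''x'' i = fst xy i))"
          by (rule triple_Sample) (use I in \<open>auto simp: I_def receive_def state_simps\<close>)
      next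
        fix \<omega>' s1
        assume "\<exists>xy. \<omega>' = [xy] \<and> I (Suc j) \<omega> s1 \<and>
            imem s1 ''y'' 0 = snd xy \<and> (\<forall>i\<in>{1..d}. imem s1 ''x'' i = fst xy i)"
        then obtain xy where xy: "\<omega>' = [xy]" "I (Suc j) \<omega> s1"
            "imem s1 ''y'' 0 = snd xy" "\<forall>i\<in>{1..d}. imem s1 ''x'' i = fst xy i"
          by blast
        have "triple d D (Seq (iassign ''i'' (IConst 0)) ?loop) s1 (d * (1 + 1 + 2 + 2) + 1 + 2) 0
            (\<lambda>_. I (Suc j) (\<omega> @ [xy]))"
          by (rule triple_ISet_Seq, rule loop) (use xy in \<open>auto simp: I_def state_simps\<close>)
        then show "triple d D (Seq (iassign ''i'' (IConst 0)) ?loop) s1 (d * (1 + 1 + 2 + 2) + 1 + 2) 0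
            (\<lambda>\<omega>''. I (Suc j) (\<omega> @ \<omega>' @ \<omega>''))"
          by (rule triple_weaken) (auto simp: xy)
      qed
    qed
    then show "bval (ILess (IConst 0) (ivar ''m'')) s' \<and>
      triple d D (Seq (iassign ''m'' (ISub (ivar ''m'') (IConst 1)))
        (Seq Sample (Seq (iassign ''i'' (IConst 0)) ?loop))) s'
        (1 + 1 + (d * (1 + 1 + 2 + 2) + 1 + 2) + 2) (1 + 0) (\<lambda>\<omega>'. I (Suc j) (\<omega> @ \<omega>'))"
      using I j by (simp add: I_def)
  qed (use assms in \<open>auto simp: I_def\<close>)
  then have "triple d D accumulate s (m * ((1 + 1 + (d * (1 + 1 + 2 + 2) + 1 + 2) + 2) + 2) + 1) m (I m)"
    by simp
  then show "triple d D accumulate s (m * (6 * d + 9) + 1) m ?Post"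
    by (rule triple_weaken) (auto simp: I_def algebra_simps)
qed

schematic_goal triple_absolute_values:
  assumes "ready d k s" "drawn s = m" "\<forall>i\<in>{1..d}. imem s ''a'' i = A i"
  shows "triple d D absolute_values s ?t 0
    (\<lambda>_ s'. ready d k s' \<and> drawn s' = m \<and> (\<forall>i\<in>{1..d}. imem s' ''a'' i = \<bar>A i\<bar>))" (is "triple _ _ _ _ _ _ ?Post")
proof -
  define I where "I j s' \<longleftrightarrow> ready d k s' \<and> drawn s' = m \<and> imem s' ''i'' 0 = int j \<and>
    (\<forall>i\<in>{1..d}. imem s' ''a'' i = (if i \<le> j then \<bar>A i\<bar> else A i))" for j s'
  have "triple d D absolute_values s (d * ((1 + 1 + 2) + 2) + 1 + 2) 0 (\<lambda>_. I d)"
    unfolding absolute_values_def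
  proof (rule triple_ISet_Seq, rule triple_While0, rule conjI)
    fix j s' assume j: "j < d" and I: "I j s'"
    show "triple d D (Seq (incr ''i'') (
       Cond (ILess (IArr ''a'' (ivar ''i'')) (IConst 0))
         (ISet ''a'' (ivar ''i'') (ISub (IConst 0) (IArr ''a'' (ivar ''i''))))
         Skip)) s' (1 + 1 + 2) 0 (\<lambda>_. I (Suc j))"
      by (intro triple_ISet_Seq triple_Cond triple_ISet triple_Skip;
          use I j in \<open>auto simp: I_def state_simps nat_add_distrib le_Suc_eq\<close>)
    show "bval (ILess (ivar ''i'') (ivar ''d'')) s'"
      using I j by (simp add: I_def ready_def)
  qed (use assms in \<open>auto simp: I_def state_simps\<close>)
  then show "triple d D absolute_values s (6 * d + 3) 0 ?Post"
    by (rule triple_weaken) (auto simp: I_def)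
qed

schematic_goal triple_argmax:
  assumes "ready d k s" "imem s ''i'' 0 = 1" "imem s ''b'' 0 = 1" "1 \<le> d"
  shows "triple d D argmax s ?t 0
    (\<lambda>_ s'. ready d k s' \<and> drawn s' = drawn s \<and> imem s' ''a'' = imem s ''a'' \<and>
       imem s' ''out'' = imem s ''out'' \<and> imem s' ''l'' = imem s ''l'' \<and>
       (\<exists>b\<in>{1..d}. imem s' ''b'' 0 = int b \<and> (\<forall>i\<in>{1..d}. imem s ''a'' i \<le> imem s ''a'' b)))" (is "triple _ _ _ _ _ _ ?Post")
proof -
  \<comment> \<open>The scan starts with index 1 already examined; after \<open>j\<close> rounds the
    indices up to \<open>Suc j\<close> are covered, and \<open>d - 1\<close> rounds suffice.\<close>
  define I where "I j s' \<longleftrightarrow> ready d k s' \<and> drawn s' = drawn s \<and> imem s' ''i'' 0 = int j + 1 \<and>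
    imem s' ''a'' = imem s ''a'' \<and> imem s' ''out'' = imem s ''out'' \<and> imem s' ''l'' = imem s ''l'' \<and>
    (\<exists>b\<in>{1..Suc j}. imem s' ''b'' 0 = int b \<and> (\<forall>i\<in>{1..Suc j}. imem s ''a'' i \<le> imem s ''a'' b))"
    for j s'
  have "triple d D argmax s ((d - 1) * ((1 + 1 + 2) + 2) + 1) 0 (\<lambda>_. I (d - 1))"
    unfolding argmax_def
  proof (rule triple_While0, rule conjI)
    fix j s' assume j: "j < d - 1" and I: "I j s'"
    then obtain b where b: "b \<in> {1..Suc j}" "imem s' ''b'' 0 = int b"
      "\<forall>i\<in>{1..Suc j}. imem s ''a'' i \<le> imem s ''a'' b"
      by (auto simp: I_def)
    have j2: "nat (2 + int j) = Suc (Suc j)" "nat (int j + 2) = Suc (Suc j)" by simp_all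
    show "triple d D (Seq (incr ''i'') (
       Cond (ILess (IArr ''a'' (ivar ''b'')) (IArr ''a'' (ivar ''i'')))
         (iassign ''b'' (ivar ''i'')) Skip)) s' (1 + 1 + 2) 0 (\<lambda>_. I (Suc j))"
    proof (intro triple_ISet_Seq triple_Cond triple_ISet triple_Skip, goal_cases)
      case 1
      then have "imem s ''a'' b < imem s ''a'' (Suc (Suc j))"
        using I b by (simp add: I_def state_simps j2)
      then have "\<forall>i\<in>{1..Suc (Suc j)}. imem s ''a'' i \<le> imem s ''a'' (Suc (Suc j))"
        using b(3) by (force simp: le_Suc_eq intro: order.trans[OF _ less_imp_le])
      then show ?case
        using I by (auto simp: I_def state_simps j2 intro!: bexI[of _ "Suc (Suc j)"])
    next
      case 2
      then have "imem s ''a'' (Suc (Suc j)) \<le> imem s ''a'' b"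
        using I b by (simp add: I_def state_simps j2)
      then have "\<forall>i\<in>{1..Suc (Suc j)}. imem s ''a'' i \<le> imem s ''a'' b"
        using b(3) by (auto simp: atLeastAtMostSuc_conv)
      then show ?case
        using I b by (auto simp: I_def state_simps intro!: bexI[of _ b])
    qed
    show "bval (ILess (ivar ''i'') (ivar ''d'')) s'"
      using I j by (simp add: I_def ready_def)
  next
    fix s' assume "I (d - 1) s'"
    then show "\<not> bval (ILess (ivar ''i'') (ivar ''d'')) s'"
      using assms by (simp add: I_def ready_def)
  qed (use assms in \<open>simp add: I_def\<close>)
  then show "triple d D argmax s ((d - 1) * 6 + 1) 0 ?Post"
   
    by (rule triple_weaken) (use assms in \<open>auto simp: I_def\<close>)
qed

schematic_goal triple_select_largest:
  assumes "ready d k s" "drawn s = m" "\<forall>i\<in>{1..d}. imem s ''a'' i = A i"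
    and "\<forall>i\<in>{1..d}. 0 \<le> A i" and "k \<le> d"
  shows "triple d D select_largest s ?t 0
    (\<lambda>_ s'. drawn s' = m \<and> top_set d A (output_set k s') \<and> card (output_set k s') = k)" (is "triple _ _ _ _ _ _ ?Post")
proof -
  \<comment> \<open>The first \<open>j\<close> outputs form a top set of exactly \<open>j\<close>
    distinct indices, and they are the indices marked by -1.\<close>
  define I where "I j s' \<longleftrightarrow> ready d k s' \<and> drawn s' = m \<and> imem s' ''l'' 0 = int j \<and>
    top_set d A (output_set j s') \<and> card (output_set j s') = j \<and>
    (\<forall>i\<in>{1..d}. imem s' ''a'' i = (if i \<in> output_set j s' then - 1 else A i))" for j s'
  let ?out = "ISet ''out'' (ivar ''l'') (ivar ''b'')" and ?mark = "ISet ''a'' (ivar ''b'') (IConst (-1))"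
  have "triple d D select_largest s
      (k * (((d - 1) * 6 + 1 + 1 + (1 + 2) + 2 + 2 + 2) + 2) + 1 + 2) 0 (\<lambda>_. I k)"
    unfolding select_largest_def
  proof (rule triple_ISet_Seq, rule triple_While0, rule conjI)
    fix j s' assume j: "j < k" and I: "I j s'"
    define J where "J = output_set j s'"
    have s': "ready d k s'" "drawn s' = m" "imem s' ''l'' 0 = int j"
      and J: "J \<subseteq> {1..d}" "card J = j" "\<forall>i\<in>J. \<forall>i'\<in>{1..d} - J. A i' \<le> A i"
      and a: "\<forall>i\<in>{1..d}. imem s' ''a'' i = (if i \<in> J then - 1 else A i)"
      using I by (simp_all add: I_def J_def top_set_def)
    have "\<not> {1..d} \<subseteq> J"
      using J j \<open>k \<le> d\<close> card_mono[OF finite_subset[OF J(1)], of "{1..d}"] by auto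
    then obtain i0 where i0: "i0 \<in> {1..d} - J" by blast
    have "triple d D (Seq (incr ''l'') (Seq (iassign ''b'' (IConst 1)) (Seq (iassign ''i'' (IConst 1)) (
       Seq argmax (Seq ?out ?mark))))) s' ((d - 1) * 6 + 1 + 1 + (1 + 2) + 2 + 2 + 2) (0 + 0) (\<lambda>_. I (Suc j))"
    proof (rule triple_ISet_Seq, rule triple_ISet_Seq, rule triple_ISet_Seq, rule triple_Seq,
        rule triple_argmax[where k = k], goal_cases)
      case (5 \<omega> s1)
      then obtain b where s1: "ready d k s1" "drawn s1 = m" "imem s1 ''a'' = imem s' ''a''"
        "imem s1 ''out'' = imem s' ''out''" "imem s1 ''l'' 0 = int (Suc j)"
        and b: "b \<in> {1..d}" "imem s1 ''b'' 0 = int b" "\<forall>i\<in>{1..d}. imem s' ''a'' i \<le> imem s' ''a'' b"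
        using s' by (auto simp: state_simps)
      \<comment> \<open>The unmarked index \<open>i0\<close> has a nonnegative entry, so the maximum
        is nonnegative and cannot sit at a marked index.\<close>
      have "0 \<le> imem s' ''a'' b"
        using a b(3) i0 assms(4) by (metis DiffE order_trans)
      then have bJ: "b \<notin> J" using a b(1) by auto
      then have max: "A i \<le> A b" if "i \<in> {1..d} - J" for i
        using a b that by (metis DiffE)
      \<comment> \<open>Earlier outputs dominate \<open>b\<close> and all remaining indices because
        these lay outside \<open>J\<close>; \<open>b\<close> dominates the remaining ones as a
        maximiser.\<close>
      have top: "top_set d A (insert b J)"
        using J b(1) max by (auto simp: top_set_def)
      let ?s = "iset ''a'' b (- 1) (iset ''out'' (Suc j) (int b) s1)"
      have out: "output_set (Suc j) ?s = insert b J"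
        using s1(4) by (auto simp: output_set_def J_def state_simps atLeastAtMostSuc_conv)
      have "I (Suc j) ?s"
        unfolding I_def out using s1 top a bJ J finite_subset[OF J(1)]
        by (auto simp: state_simps)
      then show ?case
        by (intro triple_ISet_Seq triple_ISet) (use s1 b in \<open>simp add: state_simps nat_add_distrib\<close>)
    qed (use s' j \<open>k \<le> d\<close> in \<open>simp_all add: state_simps\<close>)
    then show "triple d D (Seq (incr ''l'') (Seq (iassign ''b'' (IConst 1)) (Seq (iassign ''i'' (IConst 1)) (
       Seq argmax (Seq ?out ?mark))))) s' ((d - 1) * 6 + 1 + 1 + (1 + 2) + 2 + 2 + 2) 0 (\<lambda>_. I (Suc j))"
      by simp
    show "bval (ILess (ivar ''l'') (ivar ''k'')) s'"
      using I j by (simp add: I_def ready_def)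
  next
    fix s' assume "I k s'"
    then show "\<not> bval (ILess (ivar ''l'') (ivar ''k'')) s'"
      by (simp add: I_def ready_def)
  qed (use assms in \<open>simp add: I_def state_simps output_set_def top_set_def\<close>)
  then show "triple d D select_largest s (k * (6 * d + 12) + 3) 0 ?Post"
   
  proof (rule triple_weaken)
    \<comment> \<open>For positive \<open>d\<close> a round takes at most \<open>6 * d + 7\<close>
      steps; for \<open>d = 0\<close>, where \<open>d - 1\<close> is truncated, also
      \<open>k = 0\<close>.\<close>
    show "k * (((d - 1) * 6 + 1 + 1 + (1 + 2) + 2 + 2 + 2) + 2) + 1 + 2 \<le> k * (6 * d + 12) + 3"
      using assms(5) by (cases d) (auto simp: algebra_simps)
  qed (auto simp: I_def)
qed

section \<open>Composition of the phases and the resulting guarantee\<close>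

lemma run_heavy_coordinates:
  assumes "0 < \<eta>" "\<eta> < 1" "1 \<le> k" "k \<le> d"
  obtains G where "run d D (time_bound d \<eta>) (heavy_coordinates, init d k \<eta>) =
      map_pmf (\<lambda>\<omega>. (Skip, G \<omega>)) (replicate_pmf (num_samples d \<eta>) D)"
    and "\<And>\<omega>. \<omega> \<in> set_pmf (replicate_pmf (num_samples d \<eta>) D) \<Longrightarrow>
      drawn (G \<omega>) = num_samples d \<eta> \<and> card (output_set k (G \<omega>)) = k \<and>
      top_set d (\<lambda>i. \<bar>correlation \<omega> i\<bar>) (output_set k (G \<omega>))"
proof -
  define N where "N = inverse_ceiling \<eta>"
  define m where "m = num_samples d \<eta>"
  \<comment> \<open>\<open>A\<close> is what \<open>accumulate\<close> leaves behind. All other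
    phases draw nothing, so their lists \<open>\<omega>0\<close>, \<open>\<omega>1\<close>,
    \<open>\<omega>2\<close> and \<open>\<omega>'\<close> are empty, and the whole list of examples
    is the one seen by \<open>accumulate\<close>.\<close>
  define A where "A = (\<lambda>\<omega> s. ready d k s \<and> drawn s = m \<and> (\<forall>i\<in>{1..d}. imem s ''a'' i = correlation \<omega> i))"
  let ?t = "5 * N + 5 + 1 + (5 * N + 5 + 1 + (5 * d + 5 + 1 + (m * (6 * d + 9) + 1 + 1 +
     (6 * d + 3 + 1 + (k * (6 * d + 12) + 3)))))"
  have "triple d D heavy_coordinates (init d k \<eta>) ?t (0 + (0 + (0 + (m + (0 + 0)))))
    (\<lambda>\<omega> s. drawn s = m \<and> top_set d (\<lambda>i. \<bar>correlation \<omega> i\<bar>) (output_set k s) \<and>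
       card (output_set k s) = k)"
    unfolding heavy_coordinates_def
  proof (rule triple_Seq)
    show "triple d D invert_eta (init d k \<eta>) (5 * N + 5) 0
      (\<lambda>\<omega> s. \<omega> = [] \<and> fresh d k s \<and> imem s ''N'' 0 = int N)"
      by (rule triple_weaken[OF triple_invert_eta[of \<eta> d k]])
        (use assms in \<open>auto simp: N_def init_def state_simps\<close>)
  next
    fix \<omega>0 :: "example list" and s0 assume s0: "\<omega>0 = [] \<and> fresh d k s0 \<and> imem s0 ''N'' 0 = int N"
    show "triple d D (Seq (add_repeatedly ''q'' ''N'' (ivar ''N'')) (
     Seq (add_repeatedly ''m'' ''d''
       (double (double (double (double (double (double (ivar ''q'')))))))) (
     Seq accumulate (Seq absolute_values select_largest)))) s0
     (5 * N + 5 + 1 + (5 * d + 5 + 1 + (m * (6 * d + 9) + 1 + 1 +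
     (6 * d + 3 + 1 + (k * (6 * d + 12) + 3))))) (0 + (0 + (m + (0 + 0))))
      (\<lambda>\<omega> s. drawn s = m \<and> top_set d (\<lambda>i. \<bar>correlation (\<omega>0 @ \<omega>) i\<bar>) (output_set k s) \<and>
       card (output_set k s) = k)"
    proof (rule triple_Seq)
      show "triple d D (add_repeatedly ''q'' ''N'' (ivar ''N'')) s0 (5 * N + 5) 0
        (\<lambda>\<omega> s. \<omega> = [] \<and> fresh d k s \<and> imem s ''q'' 0 = int (N * N))"
        by (rule triple_weaken[OF triple_add_repeatedly[where d = d and k = k and n = N and c = "int N"]])
          (use s0 in auto)
    next
      fix \<omega>1 :: "example list" and s1 assume s1: "\<omega>1 = [] \<and> fresh d k s1 \<and> imem s1 ''q'' 0 = int (N * N)"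
      show "triple d D (Seq (add_repeatedly ''m'' ''d''
       (double (double (double (double (double (double (ivar ''q'')))))))) (
     Seq accumulate (Seq absolute_values select_largest))) s1
     (5 * d + 5 + 1 + (m * (6 * d + 9) + 1 + 1 +
     (6 * d + 3 + 1 + (k * (6 * d + 12) + 3)))) (0 + (m + (0 + 0)))
      (\<lambda>\<omega> s. drawn s = m \<and> top_set d (\<lambda>i. \<bar>correlation (\<omega>0 @ \<omega>1 @ \<omega>) i\<bar>) (output_set k s) \<and>
       card (output_set k s) = k)"
      proof (rule triple_Seq)
        show "triple d D (add_repeatedly ''m'' ''d''
            (double (double (double (double (double (double (ivar ''q'')))))))) s1 (5 * d + 5) 0
          (\<lambda>\<omega> s. \<omega> = [] \<and> fresh d k s \<and> imem s ''m'' 0 = int m)"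
          by (rule triple_weaken[OF triple_add_repeatedly[where d = d and k = k and n = d and c = "64 * int (N * N)"]])
            (use s1 in \<open>auto simp: m_def num_samples_def N_def power2_eq_square fresh_def ready_def\<close>)
      next
        fix \<omega>2 :: "example list" and s2 assume s2: "\<omega>2 = [] \<and> fresh d k s2 \<and> imem s2 ''m'' 0 = int m"
        show "triple d D (Seq accumulate (Seq absolute_values select_largest)) s2
         (m * (6 * d + 9) + 1 + 1 + (6 * d + 3 + 1 + (k * (6 * d + 12) + 3))) (m + (0 + 0))
          (\<lambda>\<omega> s. drawn s = m \<and> top_set d (\<lambda>i. \<bar>correlation (\<omega>0 @ \<omega>1 @ \<omega>2 @ \<omega>) i\<bar>) (output_set k s) \<and>
           card (output_set k s) = k)"
        proof (rule triple_Seq)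
          show "triple d D accumulate s2 (m * (6 * d + 9) + 1) m A"
            unfolding A_def
            by (rule triple_weaken[OF triple_accumulate]) (use s2 in \<open>auto simp: fresh_def\<close>)
        next
          fix \<omega> s3 assume A: "A \<omega> s3"
          show "triple d D (Seq absolute_values select_largest) s3
             (6 * d + 3 + 1 + (k * (6 * d + 12) + 3)) (0 + 0)
             (\<lambda>\<omega>'. \<lambda>s. drawn s = m \<and> top_set d (\<lambda>i. \<bar>correlation (\<omega>0 @ \<omega>1 @ \<omega>2 @ \<omega> @ \<omega>') i\<bar>)
               (output_set k s) \<and> card (output_set k s) = k)"
          proof (rule triple_Seq)
            show "triple d D absolute_values s3 (6 * d + 3) 0
              (\<lambda>\<omega>' s. \<omega>' = [] \<and> ready d k s \<and> drawn s = m \<and>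
                (\<forall>i\<in>{1..d}. imem s ''a'' i = \<bar>correlation \<omega> i\<bar>))"
              by (rule triple_weaken[OF triple_absolute_values[where m = m]])
                (use A in \<open>auto simp: A_def\<close>)
          next
            fix \<omega>' :: "example list" and s4
            assume s4: "\<omega>' = [] \<and> ready d k s4 \<and> drawn s4 = m \<and>
                (\<forall>i\<in>{1..d}. imem s4 ''a'' i = \<bar>correlation \<omega> i\<bar>)"
            show "triple d D select_largest s4 (k * (6 * d + 12) + 3) 0
              (\<lambda>\<omega>''. \<lambda>s. drawn s = m \<and> top_set d (\<lambda>i. \<bar>correlation (\<omega>0 @ \<omega>1 @ \<omega>2 @ \<omega> @ \<omega>' @ \<omega>'') i\<bar>)
                (output_set k s) \<and> card (output_set k s) = k)"
              by (rule triple_weaken[OF triple_select_largest[where m = m]])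
                (use s0 s1 s2 s4 \<open>k \<le> d\<close> in simp_all)
          qed
        qed
      qed
    qed
  qed
  then have "triple d D heavy_coordinates (init d k \<eta>) (time_bound d \<eta>) m
    (\<lambda>\<omega> s. drawn s = m \<and> card (output_set k s) = k \<and>
       top_set d (\<lambda>i. \<bar>correlation \<omega> i\<bar>) (output_set k s))"
    unfolding add_0_left add_0_right
  proof (rule triple_weaken)
    have N: "1 \<le> N" using inverse_ceiling_bounds(3)[OF assms(1,2)] by (simp add: N_def)
    have d: "1 \<le> d" using assms by simp
    \<comment> \<open>Every term of the total time is bounded by a constant multiple of
      \<open>X\<close>, which leaves a linear inequality.\<close>
    define X where "X = d\<^sup>2 * N\<^sup>2"
    have m: "m = 64 * d * N\<^sup>2" by (simp add: m_def num_samples_def N_def)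
    have *: "1 \<le> d\<^sup>2" "1 \<le> N\<^sup>2" "N \<le> N\<^sup>2" "d \<le> d\<^sup>2" "k * d \<le> d\<^sup>2" "k \<le> d\<^sup>2" "d \<le> d\<^sup>2"
      using N d assms(3,4) by (auto simp: power2_eq_square intro: le_trans[OF assms(4)])
    have "N \<le> X" "d \<le> X" "k \<le> X" "k * d \<le> X" "d * N\<^sup>2 \<le> X" "1 \<le> X"
      using mult_le_mono[OF *(1) *(3)] mult_le_mono[OF *(4) *(2)] mult_le_mono[OF *(6) *(2)]
        mult_le_mono[OF *(5) *(2)] mult_le_mono[OF *(4) order_refl[of "N\<^sup>2"]] mult_le_mono[OF *(1) *(2)]
      by (simp_all add: X_def)
    moreover have "m * (6 * d + 9) = 384 * X + 576 * (d * N\<^sup>2)"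
      by (simp add: m X_def power2_eq_square algebra_simps)
    moreover have "k * (6 * d + 12) = 6 * (k * d) + 12 * k"
      by (simp add: algebra_simps)
    moreover have "time_bound d \<eta> = 2000 * X"
      by (simp add: time_bound_def X_def N_def)
    ultimately show "?t \<le> time_bound d \<eta>"
      by linarith
  qed auto
  then show thesis
    using that unfolding triple_def m_def by blast
qed

text \<open>Halting and the number of draws hold on every path. As the final state is a function of
  the list of examples, the success probability is computed over lists, where closeness of all
  correlations implies success.\<close>

lemma heavy_coordinates_correct:
  assumes asm: "1 \<le> k \<and> k \<le> d \<and> 0 < \<eta> \<and> \<eta> < 1 \<and> set_pmf D \<subseteq> cube d \<times> {-1, 1} \<and>
        tv_dist D (halfspace_pmf d v \<tau>) \<le> \<eta>"
  shows "(\<forall>(Q, s) \<in> set_pmf (run d D (time_bound d \<eta>) (heavy_coordinates, init d k \<eta>)).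
            Q = Skip \<and> drawn s \<le> num_samples d \<eta>) \<and>
        measure_pmf.prob (run d D (time_bound d \<eta>) (heavy_coordinates, init d k \<eta>))
          {(Q, s). output_set k s \<subseteq> {1..d} \<and> card (output_set k s) = k \<and>
             (\<exists>w::nat \<Rightarrow> real. largest_coeffs_at d w (output_set k s) \<and>
                measure_pmf.prob (pmf_of_set (cube d))
                  {x. halfspace d v \<tau> x \<noteq> halfspace d w \<tau> x} \<le> 4 * \<eta> * real k)}
          \<ge> 0.995"
proof -
  define m where "m = num_samples d \<eta>"
  let ?run = "run d D (time_bound d \<eta>) (heavy_coordinates, init d k \<eta>)"
  let ?success = "\<lambda>s. output_set k s \<subseteq> {1..d} \<and> card (output_set k s) = k \<and>
     (\<exists>w. largest_coeffs_at d w (output_set k s) \<and> measure_pmf.prob (pmf_of_set (cube d))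
       {x. halfspace d v \<tau> x \<noteq> halfspace d w \<tau> x} \<le> 4 * \<eta> * real k)"
  let ?close = "\<lambda>\<omega>. \<forall>i\<in>{1..d}. \<bar>correlation \<omega> i - m * chow d v \<tau> i\<bar> \<le> m * (4 * \<eta>)"
  obtain G where run: "?run = map_pmf (\<lambda>\<omega>. (Skip, G \<omega>)) (replicate_pmf m D)"
    and G: "\<And>\<omega>. \<omega> \<in> set_pmf (replicate_pmf m D) \<Longrightarrow> drawn (G \<omega>) = m \<and>
      card (output_set k (G \<omega>)) = k \<and> top_set d (\<lambda>i. \<bar>correlation \<omega> i\<bar>) (output_set k (G \<omega>))"
    using run_heavy_coordinates[of \<eta> k d D] asm unfolding m_def by blast
  have "0 < m"
    using asm inverse_ceiling_bounds(3)[of \<eta>] by (auto simp: m_def num_samples_def)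
  have success: "?success (G \<omega>)" if \<omega>: "\<omega> \<in> set_pmf (replicate_pmf m D)" "?close \<omega>" for \<omega>
  proof -
    have top: "top_set d (\<lambda>i. \<bar>correlation \<omega> i\<bar>) (output_set k (G \<omega>))"
      and card: "card (output_set k (G \<omega>)) = k"
      using G[OF \<omega>(1)] by simp_all
    obtain w where "largest_coeffs_at d w (output_set k (G \<omega>))"
      "measure_pmf.prob (pmf_of_set (cube d))
         {x. halfspace d v \<tau> x \<noteq> halfspace d w \<tau> x} \<le> 4 * \<eta> * real k"
      by (rule exists_vector_of_top_set[OF top card \<open>0 < m\<close> _ \<omega>(2)]) (use asm in simp)
    with top card show ?thesis unfolding top_set_def by blast
  qed
  have "0.995 \<le> measure_pmf.prob (replicate_pmf m D) {\<omega>. ?close \<omega>}"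
    using asm by (intro prob_correlation_close) (auto simp: m_def)
  also have "\<dots> \<le> measure_pmf.prob (replicate_pmf m D) {\<omega>. ?success (G \<omega>)}"
    \<comment> \<open>The properties of \<open>G\<close> are known on the support only, so the
      inclusion of events is almost sure.\<close>
    by (rule measure_pmf.finite_measure_mono_AE)
      (use success in \<open>simp_all add: AE_measure_pmf_iff\<close>)
  also have "\<dots> = measure_pmf.prob ?run {(Q, s). ?success s}"
    unfolding run by (simp add: vimage_def)
  finally show "(\<forall>(Q, s) \<in> set_pmf ?run. Q = Skip \<and> drawn s \<le> num_samples d \<eta>) \<and>
      measure_pmf.prob ?run {(Q, s). ?success s} \<ge> 0.995"
    using G by (auto simp: run m_def)
qed

theorem theorem8p6:
  "\<exists>(P::com) (T::nat \<Rightarrow> real \<Rightarrow> nat) (M::nat \<Rightarrow> real \<Rightarrow> nat).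
     poly_bounded T \<and> poly_bounded M \<and>
     (\<forall>(d::nat) (k::nat) (\<eta>::real) (D::((nat \<Rightarrow> int) \<times> int) pmf) (v::nat \<Rightarrow> real) (\<tau>::real).
        1 \<le> k \<and> k \<le> d \<and> 0 < \<eta> \<and> \<eta> < 1 \<and>
        set_pmf D \<subseteq> cube d \<times> {-1, 1} \<and>
        tv_dist D (halfspace_pmf d v \<tau>) \<le> \<eta> \<longrightarrow>
        (\<forall>(Q, s) \<in> set_pmf (run d D (T d \<eta>) (P, init d k \<eta>)).
            Q = Skip \<and> drawn s \<le> M d \<eta>) \<and>
        measure_pmf.prob (run d D (T d \<eta>) (P, init d k \<eta>))
          {(Q, s). output_set k s \<subseteq> {1..d} \<and> card (output_set k s) = k \<and>
             (\<exists>w::nat \<Rightarrow> real. largest_coeffs_at d w (output_set k s) \<and>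
                measure_pmf.prob (pmf_of_set (cube d))
                  {x. halfspace d v \<tau> x \<noteq> halfspace d w \<tau> x} \<le> 4 * \<eta> * real k)}
          \<ge> 0.995)"
  by (rule exI[of _ heavy_coordinates], rule exI[of _ time_bound], rule exI[of _ num_samples],
    intro conjI[OF poly_bounded_time_bound conjI[OF poly_bounded_num_samples]] allI impI
      heavy_coordinates_correct)

end
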